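(* Consider a two-phase composite with isotropic phases $\mathsf L_j=\sigma_j\otimes I_2+r_j\mathsf T$, $j=1,2$, and volume fractions $f_1,f_2$. Suppose $\sigma_1=\theta_1\sigma_0$, $\sigma_2=\theta_2\sigma_0$ with $\theta_1,\theta_2>0$ and $\sigma_0$ symmetric positive definite, and \[ |r_1-r_2|=|\theta_1-\theta_2|\sqrt{\det\sigma_0}. \] Then, regardless of the microstructure, $\mathsf L^*=\sigma^*\otimes I_2+r^*\mathsf T$ with \[ \sigma^*=(f_1\sigma_1^{-1}+f_2\sigma_2^{-1})^{-1},\qquad r^*=\frac{r_1f_1\theta_1^{-1}+r_2f_2\theta_2^{-1}}{f_1\theta_1^{-1}+f_2\theta_2^{-1}} . \]
   Context: Let $R_\perp=\begin{pmatrix}0&-1\\1&0\end{pmatrix}$ and let $I_2$ be the $2\times2$ identity. Let $\mathcal T=\mathbb R^2\oplus\mathbb R^2$. Operators on $\mathcal T$ are written as $2\times2$ block matrices with real $2\times 2$ blocks, and $A\otimes B$ is the block matrix with blocks $A_{ij}B$. Put $\mathsf T=R_\perp\otimes R_\perp$. The phases $\mathsf L_j=\sigma_j\otimes I_2+r_j\mathsf T$ are assumed positive definite: $\sigma_j$ is a real symmetric positive definite $2\times2$ matrix and $r_j\in\mathbb R$ with $r_j^2<\det\sigma_j$. A two-phase composite is given by a measurable partition of the period cell $[0,1]^2=A_1\cup A_2$ (the microstructure), with volume fractions $f_j=|A_j|$, and the periodic tensor field $\mathsf L(x)=\mathsf L_j$ for $x\in A_j$. Its effective tensor $\mathsf L^*$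 is defined by $\mathsf L^*E_0=\int_{[0,1]^2}\mathsf L(x)E(x)\,dx$ for $E_0\in\mathcal T$, where $E=E_0+(\nabla\varphi_1,\nabla\varphi_2)$ with $\varphi_1,\varphi_2\in H^1_{\rm per}$ is the unique such field for which both $\mathbb R^2$-components of $\mathsf L E$ are divergence-free. *)

theory Defs
  imports "HOL-Analysis.Analysis"
begin

text \<open>
  An element \<open>E\<close> of \<open>\<real>\<^sup>2 \<oplus> \<real>\<^sup>2\<close> has the summands \<open>E $ 1\<close> and \<open>E $ 2\<close>; an operator \<open>M\<close> on this
  space is a block matrix with the \<open>2 \<times> 2\<close> blocks \<open>M $ a $ b\<close>.
\<close>

type_synonym field_space = "(real^2)^2"
type_synonym block_op = "(real^2^2)^2^2"

definition block_apply :: "block_op \<Rightarrow> field_space \<Rightarrow> field_space" where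
  "block_apply M E = (\<chi> a. \<Sum>b\<in>UNIV. (M $ a $ b) *v (E $ b))"

definition kron :: "real^2^2 \<Rightarrow> real^2^2 \<Rightarrow> block_op" where
  "kron A B = (\<chi> a b. (A $ a $ b) *\<^sub>R B)"

definition R_perp :: "real^2^2" where
  "R_perp = vector [vector [0, -1], vector [1, 0]]"

definition T_perp :: block_op where
  "T_perp = kron R_perp R_perp"

definition iso_tensor :: "real^2^2 \<Rightarrow> real \<Rightarrow> block_op" where
  "iso_tensor \<sigma> r = kron \<sigma> (mat 1) + r *\<^sub>R T_perp"

definition sym_pos_def :: "real^2^2 \<Rightarrow> bool" where
  "sym_pos_def \<sigma> \<longleftrightarrow> transpose \<sigma> = \<sigma> \<and> (\<forall>v. v \<noteq> 0 \<longrightarrow> v \<bullet> (\<sigma> *v v) > 0)"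

definition admissible_phase :: "real^2^2 \<Rightarrow> real \<Rightarrow> bool" where
  "admissible_phase \<sigma> r \<longleftrightarrow> sym_pos_def \<sigma> \<and> r\<^sup>2 < det \<sigma>"


definition unit_cell :: "(real^2) set" where
  "unit_cell = cbox 0 1"

definition cell_measure :: "(real^2) measure" where
  "cell_measure = lebesgue_on unit_cell"

definition periodic :: "(real^2 \<Rightarrow> 'b) \<Rightarrow> bool" where
  "periodic f \<longleftrightarrow> (\<forall>x i. f (x + axis i 1) = f x)"

definition L2_cell :: "(real^2 \<Rightarrow> 'b::euclidean_space) \<Rightarrow> bool" where
  "L2_cell f \<longleftrightarrow> f \<in> borel_measurable cell_measure \<and> integrable cell_measure (\<lambda>x. (norm (f x))\<^sup>2)"

definition C1_per :: "(real^2 \<Rightarrow> real) \<Rightarrow> (real^2 \<Rightarrow> real^2) \<Rightarrow> bool" where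
  "C1_per \<psi> d\<psi> \<longleftrightarrow> periodic \<psi> \<and> continuous_on UNIV d\<psi> \<and>
     (\<forall>x. (\<psi> has_derivative (\<lambda>h. d\<psi> x \<bullet> h)) (at x))"

text \<open>
  \<open>H1_per \<phi> g\<close>: the function \<open>\<phi>\<close> is in \<open>H\<^sup>1\<close> of the torus, with weak gradient \<open>g\<close>. Test functions are
  periodic and need not vanish on the boundary of the cell, so a jump of \<open>\<phi>\<close> across opposite sides
  of the cell is excluded. By mollification, \<open>C\<^sup>1\<close> and \<open>C\<^sup>\<infinity>\<close> test functions give the same notion, here
  and in \<open>div_free\<close>. Only the values of \<open>g\<close> on the cell matter.
\<close>

definition H1_per :: "(real^2 \<Rightarrow> real) \<Rightarrow> (real^2 \<Rightarrow> real^2) \<Rightarrow> bool" where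
  "H1_per \<phi> g \<longleftrightarrow> periodic \<phi> \<and> L2_cell \<phi> \<and> L2_cell g \<and>
     (\<forall>\<psi> d\<psi>. C1_per \<psi> d\<psi> \<longrightarrow>
        (\<forall>i. (LINT x|cell_measure. \<phi> x * d\<psi> x $ i) = - (LINT x|cell_measure. g x $ i * \<psi> x)))"

definition div_free :: "(real^2 \<Rightarrow> real^2) \<Rightarrow> bool" where
  "div_free J \<longleftrightarrow> L2_cell J \<and>
     (\<forall>\<psi> d\<psi>. C1_per \<psi> d\<psi> \<longrightarrow> (LINT x|cell_measure. J x \<bullet> d\<psi> x) = 0)"

text \<open>
  Tensor fields are periodic and enter only through their values on the cell.
\<close>

definition cell_solution ::
    "(real^2 \<Rightarrow> block_op) \<Rightarrow> field_space \<Rightarrow> (real^2 \<Rightarrow> field_space) \<Rightarrow> bool" where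
  "cell_solution L E0 E \<longleftrightarrow>
     (\<exists>\<phi> g. (\<forall>a. H1_per (\<phi> a) (g a)) \<and> (\<forall>x. E x = E0 + (\<chi> a. g a x))) \<and>
     (\<forall>a. div_free (\<lambda>x. block_apply (L x) (E x) $ a))"

definition is_effective_tensor :: "(real^2 \<Rightarrow> block_op) \<Rightarrow> block_op \<Rightarrow> bool" where
  "is_effective_tensor L Ls \<longleftrightarrow>
     (\<forall>E0. \<exists>E. cell_solution L E0 E \<and>
        block_apply Ls E0 = (LINT x|cell_measure. block_apply (L x) (E x)))"

definition effective_tensor :: "(real^2 \<Rightarrow> block_op) \<Rightarrow> block_op" where
  "effective_tensor L = (THE Ls. is_effective_tensor L Ls)"

definition microstructure :: "(real^2) set \<Rightarrow> (real^2) set \<Rightarrow> bool" where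
  "microstructure A1 A2 \<longleftrightarrow> A1 \<in> sets lebesgue \<and> A2 \<in> sets lebesgue \<and>
     A1 \<union> A2 = unit_cell \<and> A1 \<inter> A2 = {}"

definition two_phase :: "(real^2) set \<Rightarrow> block_op \<Rightarrow> block_op \<Rightarrow> real^2 \<Rightarrow> block_op" where
  "two_phase A1 L1 L2 x = (if x \<in> A1 then L1 else L2)"

end

(*
  If t = +-sqrt (det sigma0) is chosen with r1 - r2 = (theta1 - theta2) t, then
  L(x) = theta(x) Q + c T with the constant tensor Q = sigma0 (x) I + t T, which has rank two.
  T is a null Lagrangian: it sends periodic gradients to divergence-free fields. So it suffices to
  find a field E of mean E0 for which theta Q E is constant, i.e. to solve Q grad(phi) = h Q E0 where
  h = 1 / (m theta) - 1 and m is the mean of 1 / theta. For the Hessian G of the periodic solution u of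
  Laplace(u) = h one has G + R G R^T = h I, and this makes phi = W grad(u) a solution for a suitable
  constant matrix W. Averaging L E = Q E0 / m + c T E gives L* = Q / m + c T for every microstructure.
  Positivity of the phases makes the cell solution unique. The Poisson equation, and the orthogonality
  of divergence-free fields to gradients, are handled with Fourier series on the cell.
*)

theory Submission
  imports Defs
begin

text \<open>Read a field value E as the 2x2 matrix with rows \<open>E $ 1\<close>,
  \<open>E $ 2\<close> and write R for \<open>R_perp\<close>. Then sigma (x) I acts as E -> sigma E
  and T as E -> R E R^T, the cofactor matrix. Symmetry of sigma0 gives sigma0 R sigma0 = det(sigma0)
  R, so for t^2 = det(sigma0) the map P E = t sigma0^-1 R E R^T is an involution. Its trace is zero,
  hence Q = sigma0 (1 + P) has rank two; this is where the hypothesis on |r1 - r2| enters. The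
  matrix W = (1 + P) E0 = sigma0^-1 Q E0 satisfies P W = W, so P (W G) = W (R G R^T) for every G,
  and for the Hessian Q (W G) = sigma0 W (G + R G R^T) = h Q E0. Solving for u asks only that h be
  square integrable with mean zero, which the choice of m provides, so the geometry of the phases
  matters only through the volume fractions. The definitions test against C^1 functions, whereas
  uniqueness pairs fluxes with H^1 gradients. Fourier coefficients bridge this gap, because testing
  with sines and cosines already fixes every relation between coefficients.\<close>

subsection \<open>Square-integrable functions on the cell\<close>

lemma space_cell_measure [simp]: "space cell_measure = cbox 0 1"
  by (simp add: cell_measure_def unit_cell_def)

lemma finite_measure_cell: "finite_measure cell_measure"
  unfolding cell_measure_def unit_cell_def
  by (rule finite_measure_lebesgue_on) simp

interpretation cell: finite_measure cell_measure
  by (rule finite_measure_cell)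

lemma measure_cell_space [simp]: "measure cell_measure (cbox 0 1) = 1"
proof -
  have "measure cell_measure (cbox 0 1) = measure lebesgue (cbox (0::real^2) 1)"
    unfolding cell_measure_def unit_cell_def by (simp add: measure_restrict_space)
  also have "\<dots> = (\<Prod>i\<in>UNIV. (1::real^2) $ i - 0 $ i)"
  proof -
    have "(0::real^2) \<in> cbox 0 1" by (simp add: mem_box_cart)
    then show ?thesis by (simp only: measure_completion cbox_borel sets_lborel) (rule content_cbox_cart, blast)
  qed
  also have "\<dots> = 1" by simp
  finally show ?thesis .
qed

lemma integral_cell_const:
  fixes c :: "'b::{banach, second_countable_topology}"
  shows "(LINT x|cell_measure. c) = c"
  by (simp add: measure_cell_space)

lemma continuous_integrable_cell:
  fixes f :: "real^2 \<Rightarrow> 'b::euclidean_space"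
  assumes "continuous_on (cbox 0 1) f"
  shows "integrable cell_measure f"
  using assms unfolding cell_measure_def unit_cell_def by (rule continuous_imp_integrable)

lemma L2_cell_measurable [measurable_dest]: "L2_cell f \<Longrightarrow> f \<in> borel_measurable cell_measure"
  by (simp add: L2_cell_def)

lemma L2_cell_integrable_sq: "L2_cell f \<Longrightarrow> integrable cell_measure (\<lambda>x. (norm (f x))\<^sup>2)"
  by (simp add: L2_cell_def)

lemma L2_cell_bound:
  fixes f :: "real^2 \<Rightarrow> 'b::euclidean_space"
  assumes "integrable cell_measure g" "f \<in> borel_measurable cell_measure"
    and "\<And>x. x \<in> cbox 0 1 \<Longrightarrow> (norm (f x))\<^sup>2 \<le> g x"
  shows "L2_cell f"
  unfolding L2_cell_def
proof
  show "integrable cell_measure (\<lambda>x. (norm (f x))\<^sup>2)"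
    by (rule Bochner_Integration.integrable_bound[OF assms(1)]) (use assms(2,3) in force)+
qed (fact assms(2))

lemma L2_cell_continuous:
  fixes f :: "real^2 \<Rightarrow> 'b::euclidean_space"
  assumes "continuous_on (cbox 0 1) f"
  shows "L2_cell f"
  unfolding L2_cell_def
  by (intro conjI borel_measurable_integrable continuous_integrable_cell continuous_intros assms)

lemma L2_cell_const: "L2_cell (\<lambda>x. c)"
  by (intro L2_cell_continuous continuous_intros)

lemma norm_add_sq_le: "(norm (a + b))\<^sup>2 \<le> 2 * (norm a)\<^sup>2 + 2 * (norm (b::'b::real_normed_vector))\<^sup>2"
proof -
  have "(norm (a + b))\<^sup>2 \<le> (norm a + norm b)\<^sup>2"
    by (intro power_mono norm_triangle_ineq) simp
  also have "\<dots> \<le> 2 * (norm a)\<^sup>2 + 2 * (norm b)\<^sup>2"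
    using sum_squares_bound[of "norm a" "norm b"] by (simp add: power2_sum)
  finally show ?thesis .
qed

lemma L2_cell_add:
  assumes "L2_cell f" "L2_cell g"
  shows "L2_cell (\<lambda>x. f x + g x)"
proof (rule L2_cell_bound)
  show "integrable cell_measure (\<lambda>x. 2 * (norm (f x))\<^sup>2 + 2 * (norm (g x))\<^sup>2)"
    using assms by (simp add: L2_cell_def)
qed (use assms norm_add_sq_le in auto)

lemma L2_cell_bounded_linear:
  fixes T :: "'b::euclidean_space \<Rightarrow> 'c::euclidean_space"
  assumes "bounded_linear T" "L2_cell f"
  shows "L2_cell (\<lambda>x. T (f x))"
proof -
  obtain K where K: "\<And>x. norm (T x) \<le> norm x * K" "K \<ge> 0"
    using bounded_linear.nonneg_bounded[OF assms(1)] by blast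
  have [measurable]: "T \<in> borel_measurable borel"
    using assms(1) by (simp add: borel_measurable_continuous_onI linear_continuous_on)
  show ?thesis
  proof (rule L2_cell_bound)
    show "integrable cell_measure (\<lambda>x. K\<^sup>2 * (norm (f x))\<^sup>2)"
      using assms by (simp add: L2_cell_def)
    show "(\<lambda>x. T (f x)) \<in> borel_measurable cell_measure" using assms(2) by measurable
    show "(norm (T (f x)))\<^sup>2 \<le> K\<^sup>2 * (norm (f x))\<^sup>2" for x
      using power_mono[OF K(1)[of "f x"], of 2] by (simp add: power_mult_distrib mult.commute)
  qed
qed

lemma L2_cell_uminus: "L2_cell f \<Longrightarrow> L2_cell (\<lambda>x. - f x)"
  by (simp add: L2_cell_def)

lemma L2_cell_diff: "L2_cell f \<Longrightarrow> L2_cell g \<Longrightarrow> L2_cell (\<lambda>x. f x - g x)"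
  using L2_cell_add[of f "\<lambda>x. - g x"] by (simp add: L2_cell_uminus)

lemma L2_cell_sum:
  "(\<And>i. i \<in> I \<Longrightarrow> L2_cell (f i)) \<Longrightarrow> L2_cell (\<lambda>x. \<Sum>i\<in>I. f i x)"
  by (induction I rule: infinite_finite_induct) (auto intro: L2_cell_const L2_cell_add)

lemma L2_cell_mult_left: "L2_cell f \<Longrightarrow> L2_cell (\<lambda>x. c * f x)"
  for c :: "'b::{euclidean_space, real_normed_algebra}"
  by (rule L2_cell_bounded_linear[OF bounded_linear_mult_right])

lemma L2_cell_vec_iff:
  fixes f :: "real^2 \<Rightarrow> ('b::euclidean_space)^2"
  shows "L2_cell f \<longleftrightarrow> (\<forall>i. L2_cell (\<lambda>x. f x $ i))"
proof
  assume "L2_cell f"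
  then show "\<forall>i. L2_cell (\<lambda>x. f x $ i)"
    using L2_cell_bounded_linear[OF bounded_linear_vec_nth] by blast
next
  assume *: "\<forall>i. L2_cell (\<lambda>x. f x $ i)"
  have "bounded_linear (\<lambda>y::'b. axis i y :: 'b^2)" for i
    by (rule linear_conv_bounded_linear[THEN iffD1], rule linearI) (auto simp: axis_def vec_eq_iff)
  then have "L2_cell (\<lambda>x. \<Sum>i\<in>UNIV. axis i (f x $ i))"
    by (intro L2_cell_sum L2_cell_bounded_linear[where T = "axis i" for i]) (use * in auto)
  moreover have "(\<Sum>i\<in>UNIV. axis i (f x $ i)) = f x" for x
    by (simp add: vec_eq_iff axis_def sum_component if_distrib cong: if_cong)
  ultimately show "L2_cell f" by simp
qed

lemma L2_cell_AE_cong: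
  fixes f g :: "real^2 \<Rightarrow> 'b::euclidean_space"
  assumes "L2_cell f" "AE x in cell_measure. f x = g x" "g \<in> borel_measurable cell_measure"
  shows "L2_cell g"
proof -
  have "integrable cell_measure (\<lambda>x. (norm (g x))\<^sup>2)"
    by (rule integrable_cong_AE_imp[OF L2_cell_integrable_sq[OF assms(1)]])
       (use assms in auto)
  then show ?thesis using assms(3) by (simp add: L2_cell_def)
qed

lemma L2_integrable_product:
  fixes prod :: "'a::euclidean_space \<Rightarrow> 'b::euclidean_space \<Rightarrow> 'c::euclidean_space"
  assumes "bounded_bilinear prod" "L2_cell f" "L2_cell g"
  shows "integrable cell_measure (\<lambda>x. prod (f x) (g x))"
proof -
  obtain K where K: "\<And>a b. norm (prod a b) \<le> norm a * norm b * K" "K \<ge> 0"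
    using bounded_bilinear.nonneg_bounded[OF assms(1)] by blast
  have m: "(\<lambda>p. prod (fst p) (snd p)) \<in> borel_measurable borel"
    by (intro borel_measurable_continuous_onI bounded_bilinear.continuous_on[OF assms(1)]
        continuous_intros)
  have "(\<lambda>x. (f x, g x)) \<in> borel_measurable cell_measure"
    using assms(2,3) by (auto simp: L2_cell_def)
  from measurable_compose[OF this m]
  have [measurable]: "(\<lambda>x. prod (f x) (g x)) \<in> borel_measurable cell_measure" by simp
  show ?thesis
  proof (rule Bochner_Integration.integrable_bound)
    show "integrable cell_measure (\<lambda>x. K * ((norm (f x))\<^sup>2 + (norm (g x))\<^sup>2))"
      using assms(2,3) by (simp add: L2_cell_def)
    have "norm (prod a b) \<le> K * ((norm a)\<^sup>2 + (norm b)\<^sup>2)" for a b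
    proof -
      have "norm a * norm b \<le> (norm a)\<^sup>2 + (norm b)\<^sup>2"
        using sum_squares_bound[of "norm a" "norm b"] mult_nonneg_nonneg[OF norm_ge_zero[of a] norm_ge_zero[of b]]
        by linarith
      then have "norm a * norm b * K \<le> ((norm a)\<^sup>2 + (norm b)\<^sup>2) * K" using K(2) by (rule mult_right_mono)
      then show ?thesis using K(1)[of a b] by (simp add: mult.commute)
    qed
    then show "AE x in cell_measure. norm (prod (f x) (g x)) \<le> norm (K * ((norm (f x))\<^sup>2 + (norm (g x))\<^sup>2))"
      using K(2) by (intro AE_I2) (auto intro: order_trans[OF _ abs_ge_self])
  qed simp
qed

lemmas L2_integrable_mult = L2_integrable_product[OF bounded_bilinear_mult]
  and L2_integrable_inner = L2_integrable_product[OF bounded_bilinear_inner]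

lemma L2_cell_integrable:
  assumes "L2_cell (f :: real^2 \<Rightarrow> 'b::euclidean_space)"
  shows "integrable cell_measure f"
  using L2_integrable_product[OF bounded_bilinear_scaleR L2_cell_const[of 1] assms] by simp

text \<open>Young's inequality with a free weight \<open>t\<close> takes the place of
  Cauchy-Schwarz: no square roots of integrals occur, and each use chooses its own
  \<open>t\<close>.\<close>

lemma L2_product_bound:
  fixes f g :: "real^2 \<Rightarrow> complex"
  assumes "L2_cell f" "L2_cell g" "t > 0"
  shows "2 * cmod (LINT x|cell_measure. f x * g x) \<le>
    t * (LINT x|cell_measure. (cmod (f x))\<^sup>2) + (LINT x|cell_measure. (cmod (g x))\<^sup>2) / t"
proof -
  have "2 * cmod (LINT x|cell_measure. f x * g x) \<le> 2 * (LINT x|cell_measure. cmod (f x * g x))"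
    using integral_norm_bound by auto
  also have "\<dots> = (LINT x|cell_measure. 2 * cmod (f x * g x))" by simp
  also have "\<dots> \<le> (LINT x|cell_measure. t * (cmod (f x))\<^sup>2 + (cmod (g x))\<^sup>2 / t)"
  proof (rule integral_mono)
    show "integrable cell_measure (\<lambda>x. 2 * cmod (f x * g x))"
      using L2_integrable_mult[OF assms(1,2)] by simp
    show "integrable cell_measure (\<lambda>x. t * (cmod (f x))\<^sup>2 + (cmod (g x))\<^sup>2 / t)"
      using assms by (simp add: L2_cell_def)
    show "2 * cmod (f x * g x) \<le> t * (cmod (f x))\<^sup>2 + (cmod (g x))\<^sup>2 / t" for x
    proof -
      have "0 \<le> (t * cmod (f x) - cmod (g x))\<^sup>2 / t" using assms(3) by simp
      also have "\<dots> = t * (cmod (f x))\<^sup>2 + (cmod (g x))\<^sup>2 / t - 2 * cmod (f x * g x)"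
        using assms(3) by (simp add: field_simps power2_eq_square norm_mult)
      finally show ?thesis by simp
    qed
  qed
  also have "\<dots> = t * (LINT x|cell_measure. (cmod (f x))\<^sup>2) + (LINT x|cell_measure. (cmod (g x))\<^sup>2) / t"
    using assms by (simp add: L2_cell_def)
  finally show ?thesis .
qed

text \<open>Working with squared norms costs a factor 2 on each term of the triangle inequality,
  which is why the later approximations aim at e / 4.\<close>

lemma L2_diff_triangle:
  fixes f g h :: "real^2 \<Rightarrow> 'b::euclidean_space"
  assumes "L2_cell f" "L2_cell g" "L2_cell h"
  shows "(LINT x|cell_measure. (norm (f x - h x))\<^sup>2) \<le>
    2 * (LINT x|cell_measure. (norm (f x - g x))\<^sup>2) + 2 * (LINT x|cell_measure. (norm (g x - h x))\<^sup>2)"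
proof -
  note i = L2_cell_integrable_sq[OF L2_cell_diff]
  have "(LINT x|cell_measure. (norm (f x - h x))\<^sup>2) \<le>
     (LINT x|cell_measure. 2 * (norm (f x - g x))\<^sup>2 + 2 * (norm (g x - h x))\<^sup>2)"
  proof (rule integral_mono)
    show "(norm (f x - h x))\<^sup>2 \<le> 2 * (norm (f x - g x))\<^sup>2 + 2 * (norm (g x - h x))\<^sup>2" for x
      using norm_add_sq_le[of "f x - g x" "g x - h x"] by simp
  qed (use assms in \<open>auto intro!: i Bochner_Integration.integrable_add\<close>)
  also have "\<dots> = 2 * (LINT x|cell_measure. (norm (f x - g x))\<^sup>2) + 2 * (LINT x|cell_measure. (norm (g x - h x))\<^sup>2)"
    by (subst Bochner_Integration.integral_add) (use assms in \<open>auto intro!: i\<close>)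
  finally show ?thesis .
qed

subsection \<open>Integrals of derivatives of periodic functions\<close>

lemma integral_cell_continuous:
  fixes f :: "real^2 \<Rightarrow> 'b::euclidean_space"
  assumes "continuous_on (cbox 0 1) f"
  shows "(LINT x|cell_measure. f x) = integral (cbox 0 1) f"
  using continuous_integrable_cell[OF assms] unfolding cell_measure_def unit_cell_def
  by (rule lebesgue_integral_eq_integral) simp

text \<open>The translated cell consists of \<open>?U\<close>, the part of the cell with x_i >= h,
  and of the slab \<open>?V\<close>, the part with x_i <= h, moved on by a full period. Periodicity
  makes the moved slab contribute the same integral as \<open>?V\<close>.\<close>

lemma integral_cell_shift:
  fixes F :: "real^2 \<Rightarrow> real"
  assumes cont: "continuous_on UNIV F" and per: "periodic F" and h: "0 \<le> h" "h \<le> 1"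
  shows "integral (cbox 0 1) (\<lambda>x. F (x + h *\<^sub>R axis i 1)) = integral (cbox 0 1) F"
proof -
  let ?e = "axis i 1 :: real^2"
  have e: "?e \<in> Basis" by (simp add: axis_in_Basis_iff)
  have io: "F integrable_on cbox a b" for a b
    using cont by (intro integrable_continuous) (auto intro: continuous_on_subset)
  let ?V = "cbox 0 (1 - (1 - h) *\<^sub>R ?e)" and ?U = "cbox (h *\<^sub>R ?e) (1::real^2)"
  have inn: "x \<bullet> ?e = x $ i" for x by (simp add: inner_axis)
  have 1: "cbox 0 1 \<inter> {x. x \<bullet> ?e \<le> h} = ?V" "cbox 0 1 \<inter> {x. x \<bullet> ?e \<ge> h} = ?U"
    "cbox (0 + h *\<^sub>R ?e) (1 + h *\<^sub>R ?e) \<inter> {x. x \<bullet> ?e \<le> 1} = ?U"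
    "cbox (0 + h *\<^sub>R ?e) (1 + h *\<^sub>R ?e) \<inter> {x. x \<bullet> ?e \<ge> 1} = cbox (0 + ?e) ((1 - (1 - h) *\<^sub>R ?e) + ?e)"
    unfolding inn using h exhaust_2[of i] by (auto simp: mem_box_cart axis_def forall_2)
  have "integral (cbox 0 1) (\<lambda>x. F (x + h *\<^sub>R ?e)) = integral (cbox 0 1) (F \<circ> ((+) (h *\<^sub>R ?e)))"
    by (simp add: o_def add.commute)
  also have "\<dots> = integral (cbox (0 + h *\<^sub>R ?e) (1 + h *\<^sub>R ?e)) F"
    by (rule integral_shift_cbox_plus)
  also have "\<dots> = integral ?U F + integral (cbox (0 + ?e) ((1 - (1 - h) *\<^sub>R ?e) + ?e)) F"
    by (subst integral_split[OF io e, of _ _ 1]) (simp only: 1)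
  also have "integral (cbox (0 + ?e) ((1 - (1 - h) *\<^sub>R ?e) + ?e)) F = integral ?V (F \<circ> ((+) ?e))"
    by (rule integral_shift_cbox_plus[symmetric])
  also have "F \<circ> ((+) ?e) = F" using per by (auto simp: periodic_def add.commute)
  also have "integral ?U F + integral ?V F = integral (cbox 0 1) F"
    by (subst integral_split[OF io e, of 0 1 h]) (simp only: 1 add.commute)
  finally show ?thesis .
qed

lemma C1_per_continuous:
  assumes "C1_per \<psi> d\<psi>"
  shows "continuous_on S \<psi>" "continuous_on S d\<psi>"
proof -
  show "continuous_on S \<psi>"
    using assms unfolding C1_per_def
    by (meson continuous_at_imp_continuous_on has_derivative_continuous)
  show "continuous_on S d\<psi>"
    using assms unfolding C1_per_def by (meson continuous_on_subset top_greatest)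
qed

text \<open>By periodicity the integral of \<open>F\<close> over the translated cell does not depend
  on the translation. Differentiating it at 0 under the integral sign gives the claim; the
  derivative is one-sided because \<open>integral_cell_shift\<close> covers translations in
  [0, 1].\<close>

lemma integral_C1_per_gradient:
  assumes "C1_per F dF"
  shows "(LINT x|cell_measure. dF x $ i) = 0"
proof -
  let ?e = "axis i 1 :: real^2"
  note c = C1_per_continuous[OF assms]
  have "((\<lambda>t. integral (cbox 0 1) (\<lambda>x. F (x + t *\<^sub>R ?e))) has_vector_derivative
      integral (cbox 0 1) (\<lambda>x. dF (x + 0 *\<^sub>R ?e) $ i)) (at 0 within {0..1})"
  proof (rule leibniz_rule_vector_derivative)
    fix t :: real and x :: "real^2"
    have "((\<lambda>t. F (x + t *\<^sub>R ?e)) has_derivative (\<lambda>h. dF (x + t *\<^sub>R ?e) \<bullet> (h *\<^sub>R ?e))) (at t within {0..1})"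
    proof (rule has_derivative_compose[where g = F])
      show "((\<lambda>t. x + t *\<^sub>R ?e) has_derivative (\<lambda>h. h *\<^sub>R ?e)) (at t within {0..1})"
        by (auto intro!: derivative_eq_intros)
      show "(F has_derivative (\<lambda>h. dF (x + t *\<^sub>R ?e) \<bullet> h)) (at (x + t *\<^sub>R ?e))"
        using assms by (simp add: C1_per_def)
    qed
    then show "((\<lambda>t. F (x + t *\<^sub>R ?e)) has_vector_derivative dF (x + t *\<^sub>R ?e) $ i) (at t within {0..1})"
      by (simp add: has_vector_derivative_def inner_axis)
  next
    show "(\<lambda>x. F (x + t *\<^sub>R ?e)) integrable_on cbox 0 1" for t
      by (intro integrable_continuous continuous_on_compose2[OF c(1)[of UNIV]] continuous_intros) auto
    show "continuous_on ({0..1} \<times> cbox 0 1) (\<lambda>(t, x). dF (x + t *\<^sub>R ?e) $ i)"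
      unfolding case_prod_unfold
      by (intro continuous_on_component continuous_on_compose2[OF c(2)[of UNIV]] continuous_intros) auto
  qed auto
  note D = this[unfolded scale_zero_left add_0_right]
  have eq: "integral (cbox 0 1) F = integral (cbox 0 1) (\<lambda>x. F (x + t *\<^sub>R ?e))" if "t \<in> {0..1}" for t
    using integral_cell_shift[OF c(1), of t i] assms that by (simp add: C1_per_def)
  have 1: "((\<lambda>t. integral (cbox 0 1) F) has_vector_derivative
      integral (cbox 0 1) (\<lambda>x. dF x $ i)) (at 0 within {0..1})"
    by (rule has_vector_derivative_transform[OF _ eq D]) simp_all
  have "integral (cbox 0 1) (\<lambda>x. dF x $ i) = 0"
    by (rule vector_derivative_unique_within_closed_interval
        [OF zero_less_one _ 1[folded box_real(2)] has_vector_derivative_const]) simp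
  then show ?thesis
    by (subst integral_cell_continuous) (auto intro!: continuous_on_component c)
qed

lemma C1_per_mult:
  assumes "C1_per F dF" "C1_per G dG"
  shows "C1_per (\<lambda>x. F x * G x) (\<lambda>x. F x *\<^sub>R dG x + G x *\<^sub>R dF x)"
  unfolding C1_per_def
proof (intro conjI allI)
  show "periodic (\<lambda>x. F x * G x)" using assms by (simp add: C1_per_def periodic_def)
  show "continuous_on UNIV (\<lambda>x. F x *\<^sub>R dG x + G x *\<^sub>R dF x)"
    by (intro continuous_intros C1_per_continuous[OF assms(1)] C1_per_continuous[OF assms(2)])
  show "((\<lambda>x. F x * G x) has_derivative (\<lambda>h. (F x *\<^sub>R dG x + G x *\<^sub>R dF x) \<bullet> h)) (at x)" for x
  proof -
    have "(F has_derivative (\<lambda>h. dF x \<bullet> h)) (at x)" "(G has_derivative (\<lambda>h. dG x \<bullet> h)) (at x)"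
      using assms by (simp_all add: C1_per_def)
    from has_derivative_mult[OF this] show ?thesis
      by (simp add: inner_add_left mult.commute)
  qed
qed

subsection \<open>Fourier modes\<close>

definition fourier_mode :: "int^2 \<Rightarrow> real^2 \<Rightarrow> complex" where
  "fourier_mode k x = cis (2 * pi * (\<Sum>i\<in>UNIV. of_int (k $ i) * x $ i))"

definition wave_vector :: "int^2 \<Rightarrow> real^2" where
  "wave_vector k = (\<chi> i. of_int (k $ i))"

definition fourier_coeff :: "(real^2 \<Rightarrow> complex) \<Rightarrow> int^2 \<Rightarrow> complex" where
  "fourier_coeff F k = (LINT x|cell_measure. F x * cnj (fourier_mode k x))"

definition trig_sum :: "(int^2 \<Rightarrow> complex) \<Rightarrow> (int^2) set \<Rightarrow> real^2 \<Rightarrow> complex" where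
  "trig_sum c K x = (\<Sum>k\<in>K. c k * fourier_mode k x)"

lemma wave_vector_nth [simp]: "wave_vector k $ i = of_int (k $ i)"
  by (simp add: wave_vector_def)

lemma fourier_mode_add: "fourier_mode (k + l) x = fourier_mode k x * fourier_mode l x"
  by (simp add: fourier_mode_def cis_mult sum_2 algebra_simps)

lemma fourier_mode_0 [simp]: "fourier_mode 0 x = 1"
  by (simp add: fourier_mode_def)

lemma cnj_fourier_mode: "cnj (fourier_mode k x) = fourier_mode (- k) x"
  by (simp add: fourier_mode_def cis_cnj sum_2 algebra_simps flip: cis_inverse)

lemma norm_fourier_mode [simp]: "cmod (fourier_mode k x) = 1"
  by (simp add: fourier_mode_def)

lemma continuous_fourier_mode [continuous_intros]: "continuous_on S (fourier_mode k)"
  unfolding fourier_mode_def cis_conv_exp by (intro continuous_intros)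

lemma L2_cell_fourier_mode: "L2_cell (fourier_mode k)"
  by (intro L2_cell_continuous continuous_intros)

lemma L2_cell_cnj: "L2_cell f \<Longrightarrow> L2_cell (\<lambda>x. cnj (f x))"
  by (rule L2_cell_bounded_linear[OF bounded_linear_cnj])

lemma L2_cell_trig_sum: "L2_cell (trig_sum c K)"
  unfolding trig_sum_def by (intro L2_cell_sum L2_cell_mult_left L2_cell_fourier_mode)

lemma integrable_coeff: "L2_cell F \<Longrightarrow> integrable cell_measure (\<lambda>x. F x * cnj (fourier_mode k x))"
  by (intro L2_integrable_mult L2_cell_cnj L2_cell_fourier_mode)

lemma fourier_mode_periodic: "fourier_mode k (x + axis i 1) = fourier_mode k x"
proof -
  have "2 * pi * (\<Sum>j\<in>UNIV. of_int (k $ j) * (x + axis i 1) $ j)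
     = 2 * pi * (\<Sum>j\<in>UNIV. of_int (k $ j) * x $ j) + 2 * pi * of_int (k $ i)"
    using exhaust_2[of i] by (auto simp: sum_2 axis_def algebra_simps)
  then show ?thesis
    by (simp add: fourier_mode_def cis_mult[symmetric] cis_multiple_2pi)
qed

lemma fourier_mode_has_derivative:
  "(fourier_mode k has_derivative (\<lambda>h. 2 * pi * \<i> * complex_of_real (wave_vector k \<bullet> h) * fourier_mode k x)) (at x)"
proof -
  have "((\<lambda>x. exp (\<i> * complex_of_real (2 * pi * (wave_vector k \<bullet> x)))) has_derivative
     (\<lambda>h. 2 * pi * \<i> * complex_of_real (wave_vector k \<bullet> h) * exp (\<i> * complex_of_real (2 * pi * (wave_vector k \<bullet> x))))) (at x)"
  proof -
    have "((\<lambda>x. \<i> * complex_of_real (2 * pi * (wave_vector k \<bullet> x))) has_derivative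
        (\<lambda>h. \<i> * complex_of_real (2 * pi * (wave_vector k \<bullet> h)))) (at x)"
      by (intro bounded_linear_imp_has_derivative bounded_linear_const_mult
          bounded_linear_compose[OF bounded_linear_of_real] bounded_linear_inner_right)
    from has_derivative_compose[OF this DERIV_exp[unfolded has_field_derivative_def]]
    show ?thesis by (simp add: mult_ac)
  qed
  then show ?thesis
    by (simp add: fourier_mode_def[abs_def] cis_conv_exp inner_vec_def)
qed

lemma C1_per_Re_fourier_mode:
  "C1_per (\<lambda>x. Re (fourier_mode k x)) (\<lambda>x. (- 2 * pi * Im (fourier_mode k x)) *\<^sub>R wave_vector k)"
  unfolding C1_per_def
proof (intro conjI allI)
  fix x
  show "((\<lambda>x. Re (fourier_mode k x)) has_derivative
      (\<lambda>h. ((- 2 * pi * Im (fourier_mode k x)) *\<^sub>R wave_vector k) \<bullet> h)) (at x)"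
    by (rule has_derivative_eq_rhs[OF has_derivative_Re[OF fourier_mode_has_derivative]])
       (simp add: fun_eq_iff)
qed (auto simp: periodic_def fourier_mode_periodic intro!: continuous_intros)

lemma C1_per_Im_fourier_mode:
  "C1_per (\<lambda>x. Im (fourier_mode k x)) (\<lambda>x. (2 * pi * Re (fourier_mode k x)) *\<^sub>R wave_vector k)"
  unfolding C1_per_def
proof (intro conjI allI)
  fix x
  show "((\<lambda>x. Im (fourier_mode k x)) has_derivative
      (\<lambda>h. ((2 * pi * Re (fourier_mode k x)) *\<^sub>R wave_vector k) \<bullet> h)) (at x)"
    by (rule has_derivative_eq_rhs[OF has_derivative_Im[OF fourier_mode_has_derivative]])
       (simp add: fun_eq_iff)
qed (auto simp: periodic_def fourier_mode_periodic intro!: continuous_intros)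

lemma integral_Re_Im:
  assumes "integrable M F"
  shows "(LINT x|M. F x) = Complex (LINT x|M. Re (F x)) (LINT x|M. Im (F x))"
  using assms by (simp add: complex_eq_iff)

text \<open>If \<open>k $ i\<close> is nonzero, the real and imaginary parts of the mode are
  multiples of i-th partial derivatives of periodic functions and therefore have mean zero. Together
  with \<open>fourier_mode_add\<close> this makes the modes orthonormal.\<close>

lemma integral_fourier_mode:
  "(LINT x|cell_measure. fourier_mode k x) = (if k = 0 then 1 else 0)"
proof (cases "k = 0")
  case False
  then obtain i where i: "k $ i \<noteq> 0" by (auto simp: vec_eq_iff)
  have "(LINT x|cell_measure. Re (fourier_mode k x)) = 0" "(LINT x|cell_measure. Im (fourier_mode k x)) = 0"
    using integral_C1_per_gradient[OF C1_per_Im_fourier_mode, of k i]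
      integral_C1_per_gradient[OF C1_per_Re_fourier_mode, of k i] i
    by auto
  then show ?thesis
    using False by (simp add: integral_Re_Im[OF L2_cell_integrable[OF L2_cell_fourier_mode]] zero_complex.code)
qed simp

lemma fourier_coeff_mode: "fourier_coeff (fourier_mode l) k = (if k = l then 1 else 0)"
  using integral_fourier_mode[of "l - k"]
  by (simp add: fourier_coeff_def cnj_fourier_mode fourier_mode_add[symmetric])

lemma fourier_coeff_diff:
  "L2_cell F \<Longrightarrow> L2_cell G \<Longrightarrow> fourier_coeff (\<lambda>x. F x - G x) k = fourier_coeff F k - fourier_coeff G k"
  by (simp add: fourier_coeff_def algebra_simps integrable_coeff)

lemma fourier_coeff_mult: "fourier_coeff (\<lambda>x. c * F x) k = c * fourier_coeff F k"
  by (simp add: fourier_coeff_def mult.assoc)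

lemma fourier_coeff_sum:
  "(\<And>i. i \<in> I \<Longrightarrow> L2_cell (F i)) \<Longrightarrow> fourier_coeff (\<lambda>x. \<Sum>i\<in>I. F i x) k = (\<Sum>i\<in>I. fourier_coeff (F i) k)"
  by (simp add: fourier_coeff_def sum_distrib_right integrable_coeff)

lemma fourier_coeff_trig_sum:
  assumes "finite K"
  shows "fourier_coeff (trig_sum c K) k = (if k \<in> K then c k else 0)"
  unfolding trig_sum_def[abs_def]
  using assms
  by (simp add: fourier_coeff_sum L2_cell_mult_left L2_cell_fourier_mode fourier_coeff_mult
      fourier_coeff_mode if_distrib cong: if_cong)

lemma integral_mult_cnj_trig_sum:
  assumes "L2_cell F"
  shows "(LINT x|cell_measure. F x * cnj (trig_sum c K x)) = (\<Sum>k\<in>K. cnj (c k) * fourier_coeff F k)"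
proof -
  have "(LINT x|cell_measure. F x * cnj (trig_sum c K x)) =
      (LINT x|cell_measure. (\<Sum>k\<in>K. cnj (c k) * (F x * cnj (fourier_mode k x))))"
    by (simp add: trig_sum_def sum_distrib_left mult_ac)
  also have "\<dots> = (\<Sum>k\<in>K. cnj (c k) * fourier_coeff F k)"
    unfolding fourier_coeff_def
    by (subst Bochner_Integration.integral_sum) (auto intro!: integrable_coeff assms)
  finally show ?thesis .
qed

lemma trig_sum_diff: "trig_sum c K x - trig_sum d K x = trig_sum (\<lambda>k. c k - d k) K x"
  by (simp add: trig_sum_def sum_subtractf algebra_simps)

lemma of_real_integral_norm_sq:
  fixes F :: "real^2 \<Rightarrow> complex"
  shows "complex_of_real (LINT x|cell_measure. (cmod (F x))\<^sup>2) = (LINT x|cell_measure. F x * cnj (F x))"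
  by (simp flip: complex_norm_square integral_complex_of_real)

lemma integral_norm_sq_trig_sum:
  assumes "finite K"
  shows "(LINT x|cell_measure. (cmod (trig_sum c K x))\<^sup>2) = (\<Sum>k\<in>K. (cmod (c k))\<^sup>2)"
proof -
  have "complex_of_real (LINT x|cell_measure. (cmod (trig_sum c K x))\<^sup>2) = complex_of_real (\<Sum>k\<in>K. (cmod (c k))\<^sup>2)"
    unfolding of_real_integral_norm_sq integral_mult_cnj_trig_sum[OF L2_cell_trig_sum]
    by (simp add: fourier_coeff_trig_sum[OF assms] complex_norm_square mult.commute del: of_real_power)
  then show ?thesis using of_real_eq_iff by blast
qed

lemma cmod_add_sq: "(cmod (a + b))\<^sup>2 = (cmod a)\<^sup>2 + (cmod b)\<^sup>2 + 2 * Re (a * cnj b)"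
  unfolding cmod_power2 by (simp add: power2_eq_square algebra_simps)

text \<open>Pythagoras: the residual \<open>?r\<close> of the Fourier partial sum is orthogonal to
  every trigonometric sum over \<open>K\<close>, in particular to the difference \<open>?d\<close>
  of the two approximants.\<close>

lemma fourier_best_approximation:
  assumes F: "L2_cell F" and K: "finite K"
  shows "(LINT x|cell_measure. (cmod (F x - trig_sum (fourier_coeff F) K x))\<^sup>2)
     \<le> (LINT x|cell_measure. (cmod (F x - trig_sum c K x))\<^sup>2)"
proof -
  let ?r = "\<lambda>x. F x - trig_sum (fourier_coeff F) K x"
  let ?d = "trig_sum (\<lambda>k. fourier_coeff F k - c k) K"
  have r: "L2_cell ?r" by (intro L2_cell_diff F L2_cell_trig_sum)
  have "(LINT x|cell_measure. ?r x * cnj (?d x)) = 0"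
    unfolding integral_mult_cnj_trig_sum[OF r]
    by (intro sum.neutral) (simp add: fourier_coeff_diff F L2_cell_trig_sum fourier_coeff_trig_sum[OF K])
  then have 0: "(LINT x|cell_measure. Re (?r x * cnj (?d x))) = 0"
    using integral_Re_Im[OF L2_integrable_mult[OF r L2_cell_cnj[OF L2_cell_trig_sum]]]
    by (simp add: complex_eq_iff)
  have i: "integrable cell_measure (\<lambda>x. Re (?r x * cnj (?d x)))"
    by (intro integrable_Re L2_integrable_mult r L2_cell_cnj L2_cell_trig_sum)
  have ij: "integrable cell_measure (\<lambda>x. (cmod (?r x))\<^sup>2 + (cmod (?d x))\<^sup>2)"
    by (intro Bochner_Integration.integrable_add L2_cell_integrable_sq r L2_cell_trig_sum)
  have "(LINT x|cell_measure. (cmod (?r x))\<^sup>2) \<le>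
     (LINT x|cell_measure. (cmod (?r x))\<^sup>2 + (cmod (?d x))\<^sup>2)"
    by (rule integral_mono[OF L2_cell_integrable_sq[OF r] ij]) simp
  also have "\<dots> = (LINT x|cell_measure. (cmod (?r x))\<^sup>2 + (cmod (?d x))\<^sup>2) + 2 * (LINT x|cell_measure. Re (?r x * cnj (?d x)))"
    unfolding 0 by simp
  also have "\<dots> = (LINT x|cell_measure. (cmod (?r x))\<^sup>2 + (cmod (?d x))\<^sup>2 + 2 * Re (?r x * cnj (?d x)))"
    by (simp only: Bochner_Integration.integral_add[OF ij integrable_mult_right[OF i, of 2]]
        integral_mult_right_zero)
  also have "\<dots> = (LINT x|cell_measure. (cmod (F x - trig_sum c K x))\<^sup>2)"
  proof (rule Bochner_Integration.integral_cong)
    fix x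
    have "F x - trig_sum c K x = ?r x + ?d x" by (simp flip: trig_sum_diff)
    then show "(cmod (?r x))\<^sup>2 + (cmod (?d x))\<^sup>2 + 2 * Re (?r x * cnj (?d x)) = (cmod (F x - trig_sum c K x))\<^sup>2"
      by (simp only: cmod_add_sq)
  qed simp
  finally show ?thesis .
qed

subsection \<open>Density of trigonometric polynomials\<close>

definition trig_poly :: "(real^2 \<Rightarrow> complex) \<Rightarrow> bool" where
  "trig_poly p \<longleftrightarrow> (\<exists>K c. finite K \<and> p = trig_sum c K)"

lemma trig_poly_mode: "trig_poly (\<lambda>x. c * fourier_mode k x)"
  unfolding trig_poly_def
  by (rule exI[of _ "{k}"], rule exI[of _ "\<lambda>_. c"]) (simp add: trig_sum_def fun_eq_iff)

lemma trig_sum_extend: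
  assumes "finite L" "K \<subseteq> L"
  shows "trig_sum c K = trig_sum (\<lambda>k. if k \<in> K then c k else 0) L"
  unfolding trig_sum_def
  by (rule ext, rule sum.mono_neutral_cong_left) (use assms in auto)

lemma trig_poly_add:
  assumes "trig_poly p" "trig_poly q"
  shows "trig_poly (\<lambda>x. p x + q x)"
proof -
  obtain K c L d where *: "finite K" "p = trig_sum c K" "finite L" "q = trig_sum d L"
    using assms by (auto simp: trig_poly_def)
  let ?c = "\<lambda>k. if k \<in> K then c k else 0" and ?d = "\<lambda>k. if k \<in> L then d k else 0"
  have "p = trig_sum ?c (K \<union> L)" "q = trig_sum ?d (K \<union> L)"
    using * trig_sum_extend[of "K \<union> L" K c] trig_sum_extend[of "K \<union> L" L d] by simp_all
  then have "(\<lambda>x. p x + q x) = trig_sum (\<lambda>k. ?c k + ?d k) (K \<union> L)"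
    by (simp only:) (simp add: trig_sum_def fun_eq_iff sum.distrib distrib_right)
  then show ?thesis unfolding trig_poly_def using *(1,3) by blast
qed

lemma trig_poly_sum:
  assumes "\<And>i. i \<in> I \<Longrightarrow> trig_poly (p i)"
  shows "trig_poly (\<lambda>x. \<Sum>i\<in>I. p i x)"
  using assms
proof (induction I rule: infinite_finite_induct)
  case (insert i I)
  then show ?case using trig_poly_add[of "p i" "\<lambda>x. \<Sum>i\<in>I. p i x"] by simp
qed (use trig_poly_mode[of 0] in auto)

lemma trig_poly_mult:
  assumes "trig_poly p" "trig_poly q"
  shows "trig_poly (\<lambda>x. p x * q x)"
proof -
  obtain K c L d where *: "p = trig_sum c K" "q = trig_sum d L"
    using assms by (auto simp: trig_poly_def)
  have "(\<lambda>x. p x * q x) = (\<lambda>x. \<Sum>k\<in>K. \<Sum>l\<in>L. (c k * d l) * fourier_mode (k + l) x)"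
    by (simp add: * trig_sum_def sum_product fourier_mode_add mult_ac fun_eq_iff)
  then show ?thesis by (simp only:) (intro trig_poly_sum trig_poly_mode)
qed

lemma trig_poly_const: "trig_poly (\<lambda>x. c)"
  using trig_poly_mode[of c 0] by simp

lemma trig_poly_cmult: "trig_poly p \<Longrightarrow> trig_poly (\<lambda>x. c * p x)"
  by (rule trig_poly_mult[OF trig_poly_const])

text \<open>The image of the cell is the torus as a compact subset of C x C, so the
  Stone-Weierstrass theorem for polynomials applies there.\<close>

definition torus_map :: "real^2 \<Rightarrow> complex \<times> complex" where
  "torus_map x = (cis (2 * pi * x $ 1), cis (2 * pi * x $ 2))"

text \<open>The real coordinates of \<open>torus_map\<close> are cosines and sines, each a
  combination of the two modes with wave vectors e_i and -e_i, and trigonometric polynomials form an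
  algebra.\<close>

lemma trig_poly_polynomial:
  fixes q :: "complex \<times> complex \<Rightarrow> real"
  assumes "real_polynomial_function q"
  shows "trig_poly (\<lambda>x. complex_of_real (q (torus_map x)))"
  using assms
proof induction
  case (linear f)
  interpret bounded_linear f by fact
  have e: "z = Re z *\<^sub>R 1 + Im z *\<^sub>R \<i>" for z by (simp add: complex_eq_iff)
  have f: "f (z, w) = Re z * f (1, 0) + Im z * f (\<i>, 0) + Re w * f (0, 1) + Im w * f (0, \<i>)" for z w
  proof -
    have "(z, w) = Re z *\<^sub>R (1, 0) + Im z *\<^sub>R (\<i>, 0) + Re w *\<^sub>R (0, 1) + Im w *\<^sub>R (0, \<i>)"
      using e[of z] e[of w] by simp
    then show ?thesis by (simp only: add scaleR real_scaleR_def)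
  qed
  have m: "fourier_mode (axis i 1) x = cis (2 * pi * x $ i)" for i x
    using exhaust_2[of i] by (auto simp: fourier_mode_def sum_2 axis_def)
  have re: "trig_poly (\<lambda>x. complex_of_real (Re (cis (2 * pi * x $ i))))" for i
  proof -
    have "complex_of_real (Re z) = (1/2) * z + (1/2) * cnj z" for z by (simp add: complex_eq_iff)
    then have "(\<lambda>x. complex_of_real (Re (cis (2 * pi * x $ i)))) =
       (\<lambda>x. (1/2) * fourier_mode (axis i 1) x + (1/2) * fourier_mode (- axis i 1) x)"
      unfolding cnj_fourier_mode[symmetric] m by blast
    then show ?thesis by (simp only: trig_poly_add trig_poly_mode)
  qed
  have im: "trig_poly (\<lambda>x. complex_of_real (Im (cis (2 * pi * x $ i))))" for i
  proof -
    have "complex_of_real (Im z) = (-\<i>/2) * z + (\<i>/2) * cnj z" for z by (simp add: complex_eq_iff)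
    then have "(\<lambda>x. complex_of_real (Im (cis (2 * pi * x $ i)))) =
       (\<lambda>x. (-\<i>/2) * fourier_mode (axis i 1) x + (\<i>/2) * fourier_mode (- axis i 1) x)"
      unfolding cnj_fourier_mode[symmetric] m by blast
    then show ?thesis by (simp only: trig_poly_add trig_poly_mode)
  qed
  have "complex_of_real (f (torus_map x)) =
        complex_of_real (Re (cis (2 * pi * x $ 1))) * complex_of_real (f (1, 0)) +
        complex_of_real (Im (cis (2 * pi * x $ 1))) * complex_of_real (f (\<i>, 0)) +
        complex_of_real (Re (cis (2 * pi * x $ 2))) * complex_of_real (f (0, 1)) +
        complex_of_real (Im (cis (2 * pi * x $ 2))) * complex_of_real (f (0, \<i>))" for x
    unfolding torus_map_def f[of "cis (2 * pi * x $ 1)" "cis (2 * pi * x $ 2)"] of_real_add of_real_mult ..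
  then show ?case
    by (simp only:) (intro trig_poly_add trig_poly_mult re im trig_poly_const)
next
  case (const c)
  show ?case by (rule trig_poly_const)
next
  case (add f g)
  then show ?case by (simp add: trig_poly_add)
next
  case (mult f g)
  then show ?case by (simp add: trig_poly_mult)
qed

text \<open>On the closed cell only boundary points are identified, and only with boundary points.
  Hence a function that vanishes on the boundary descends to the image of
  \<open>torus_map\<close>.\<close>

lemma torus_map_eq_cases:
  assumes "x \<in> cbox 0 1" "y \<in> cbox 0 1" "torus_map x = torus_map y"
  shows "x = y \<or> (x \<in> cbox 0 1 - box 0 1 \<and> y \<in> cbox 0 1 - box 0 1)"
proof -
  have *: "a = b \<or> (a \<in> {0,1} \<and> b \<in> {0,1})" if "0 \<le> a" "a \<le> 1" "0 \<le> b" "b \<le> 1" "cis (2 * pi * a) = cis (2 * pi * b)" for a b :: real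
  proof -
    have "sin (2 * pi * a) = sin (2 * pi * b) \<and> cos (2 * pi * a) = cos (2 * pi * b)"
      using that(5) by (simp add: complex_eq_iff)
    then obtain n where "2 * pi * a = 2 * pi * b + 2 * pi * real_of_int n"
      using sin_cos_eq_iff[of "2 * pi * a" "2 * pi * b"] by auto
    then have "2 * pi * a = 2 * pi * (b + real_of_int n)" by (simp add: algebra_simps)
    then have n: "a = b + real_of_int n" by simp
    then have "n = 0 \<or> n = 1 \<or> n = -1" using that by linarith
    then show ?thesis using n that by auto
  qed
  have c: "0 \<le> x $ i" "x $ i \<le> 1" "0 \<le> y $ i" "y $ i \<le> 1" for i
    using assms by (auto simp: mem_box_cart)
  have i: "x $ i = y $ i \<or> (x $ i \<in> {0,1} \<and> y $ i \<in> {0,1})" for i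
    using exhaust_2[of i] assms(3) *[OF c[of i]] by (auto simp: torus_map_def)
  show ?thesis
  proof (cases "x = y")
    case False
    then obtain j where "x $ j \<noteq> y $ j" by (auto simp: vec_eq_iff)
    then have "x $ j \<in> {0,1}" "y $ j \<in> {0,1}" using i[of j] by auto
    then have "x \<notin> box 0 1" "y \<notin> box 0 1" by (auto simp: mem_box_cart intro!: exI[of _ j])
    then show ?thesis using assms by blast
  qed simp
qed

lemma trig_poly_uniform_approximation_real:
  fixes f :: "real^2 \<Rightarrow> real"
  assumes f: "continuous_on (cbox 0 1) f" and bd: "\<And>x. x \<in> cbox 0 1 - box 0 1 \<Longrightarrow> f x = 0"
    and e: "e > 0"
  obtains p where "trig_poly p" "\<And>x. x \<in> cbox 0 1 \<Longrightarrow> cmod (complex_of_real (f x) - p x) < e"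
proof -
  let ?C = "cbox 0 (1::real^2)" and ?S = "torus_map ` cbox 0 1"
  have ct: "continuous_on ?C torus_map"
    unfolding torus_map_def cis_conv_exp by (intro continuous_intros)
  define F where "F = f \<circ> inv_into ?C torus_map"
  have F: "F (torus_map x) = f x" if "x \<in> ?C" for x
  proof -
    let ?y = "inv_into ?C torus_map (torus_map x)"
    have "?y \<in> ?C" "torus_map ?y = torus_map x"
      using that by (auto intro: inv_into_into f_inv_into_f)
    from torus_map_eq_cases[OF this(1) that this(2)] show ?thesis
      using bd by (auto simp: F_def)
  qed
  \<comment> \<open>Continuity of the descended function is read off its graph, which is a
    continuous image of the compact cell and hence closed, while the values lie in a compact
    set.\<close>
  have "continuous_on ?S F"
  proof (rule continuous_from_closed_graph)
    show "compact (f ` ?C)" by (intro compact_continuous_image f compact_cbox)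
    show "F \<in> ?S \<rightarrow> f ` ?C" using F by auto
    have "(\<lambda>x. (x, F x)) ` ?S = (\<lambda>x. (torus_map x, f x)) ` ?C"
      using F by (auto simp: image_iff)
    also have "closed \<dots>"
      by (intro compact_imp_closed compact_continuous_image continuous_intros ct f compact_cbox)
    finally show "closed ((\<lambda>x. (x, F x)) ` ?S)" .
  qed
  then obtain q where q: "real_polynomial_function q" "\<And>x. x \<in> ?S \<Longrightarrow> \<bar>F x - q x\<bar> < e"
    using Stone_Weierstrass_real_polynomial_function[of ?S F e] e
      compact_continuous_image[OF ct compact_cbox] by blast
  show ?thesis
  proof
    show "trig_poly (\<lambda>x. complex_of_real (q (torus_map x)))" by (rule trig_poly_polynomial) fact
    show "cmod (complex_of_real (f x) - complex_of_real (q (torus_map x))) < e" if "x \<in> ?C" for x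
      using q(2)[of "torus_map x"] that F[OF that]
      by (simp flip: of_real_diff)
  qed
qed

lemma trig_poly_uniform_approximation:
  fixes f :: "real^2 \<Rightarrow> complex"
  assumes f: "continuous_on (cbox 0 1) f" and bd: "\<And>x. x \<in> cbox 0 1 - box 0 1 \<Longrightarrow> f x = 0"
    and e: "e > 0"
  obtains p where "trig_poly p" "\<And>x. x \<in> cbox 0 1 \<Longrightarrow> cmod (f x - p x) < e"
proof -
  have e2: "e / 2 > 0" using e by simp
  obtain p where p: "trig_poly p" "\<And>x. x \<in> cbox 0 1 \<Longrightarrow> cmod (complex_of_real (Re (f x)) - p x) < e / 2"
    using trig_poly_uniform_approximation_real[of "\<lambda>x. Re (f x)", OF _ _ e2] f bd
    by (auto intro!: continuous_intros)
  obtain q where q: "trig_poly q" "\<And>x. x \<in> cbox 0 1 \<Longrightarrow> cmod (complex_of_real (Im (f x)) - q x) < e / 2"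
    using trig_poly_uniform_approximation_real[of "\<lambda>x. Im (f x)", OF _ _ e2] f bd
    by (auto intro!: continuous_intros)
  show ?thesis
  proof
    show "trig_poly (\<lambda>x. p x + \<i> * q x)" by (intro trig_poly_add trig_poly_cmult p q)
    show "cmod (f x - (p x + \<i> * q x)) < e" if "x \<in> cbox 0 1" for x
    proof -
      have "f x - (p x + \<i> * q x) = (complex_of_real (Re (f x)) - p x) + \<i> * (complex_of_real (Im (f x)) - q x)"
        by (simp add: complex_eq_iff)
      also have "cmod \<dots> \<le> cmod (complex_of_real (Re (f x)) - p x) + cmod (complex_of_real (Im (f x)) - q x)"
        by (rule order_trans[OF norm_triangle_ineq]) (simp add: norm_mult)
      also have "\<dots> < e" using p(2)[OF that] q(2)[OF that] by simp
      finally show ?thesis .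
    qed
  qed
qed

section \<open>Mean-square density: truncation and cutoff at the boundary\<close>

lemma AE_cell_not_negligible:
  assumes "negligible N"
  shows "AE x in cell_measure. x \<notin> N"
proof -
  have "AE x in lebesgue. x \<notin> N"
    using assms by (simp add: negligible_iff_null_sets AE_not_in)
  then show ?thesis
    unfolding cell_measure_def unit_cell_def by (subst AE_restrict_space_iff) auto
qed

text \<open>For B > 0 this is the radial retraction onto the closed disc of radius \<open>B\<close>:
  a truncation that is continuous, so that it respects pointwise limits, and that supplies the
  constant for dominated convergence.\<close>

definition clamp_norm :: "real \<Rightarrow> complex \<Rightarrow> complex" where
  "clamp_norm B z = (B / max B (cmod z)) *\<^sub>R z"

lemma clamp_norm:
  assumes "B > 0"
  shows norm_clamp_norm_le: "cmod (clamp_norm B z) \<le> B"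
    and clamp_norm_eq: "cmod z \<le> B \<Longrightarrow> clamp_norm B z = z"
    and norm_diff_clamp_norm_le: "cmod (z - clamp_norm B z) \<le> cmod z"
    and continuous_clamp_norm: "continuous_on S (clamp_norm B)"
proof -
  have "B * cmod z \<le> B * max B (cmod z)" using assms by (intro mult_left_mono) auto
  then show "cmod (clamp_norm B z) \<le> B"
    using assms by (simp add: clamp_norm_def max_def field_simps)
  show "cmod z \<le> B \<Longrightarrow> clamp_norm B z = z"
    using assms by (simp add: clamp_norm_def max_def)
  have "z - clamp_norm B z = (1 - B / max B (cmod z)) *\<^sub>R z"
    by (simp add: clamp_norm_def scaleR_left_diff_distrib)
  moreover have "0 \<le> 1 - B / max B (cmod z)" "1 - B / max B (cmod z) \<le> 1"
    using assms by (auto simp: max_def divide_le_eq)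
  ultimately show "cmod (z - clamp_norm B z) \<le> cmod z"
    by (simp add: mult_left_le_one_le)
  show "continuous_on S (clamp_norm B)"
    unfolding clamp_norm_def using assms by (intro continuous_intros) auto
qed

lemma trig_poly_dense_bounded:
  fixes F :: "real^2 \<Rightarrow> complex"
  assumes F: "F \<in> borel_measurable cell_measure" and B: "B > 0" and e: "e > 0"
  obtains p where "trig_poly p" "(LINT x|cell_measure. (cmod (clamp_norm B (F x) - p x))\<^sup>2) < e"
proof -
  have "F measurable_on (cbox 0 1)"
    using F unfolding cell_measure_def unit_cell_def by (subst measurable_on_iff_borel_measurable) auto
  then obtain N g where N: "negligible N" and g: "\<And>n. continuous_on UNIV (g n)"
    and lim: "\<And>x. x \<notin> N \<Longrightarrow> (\<lambda>n. g n x) \<longlonglongrightarrow> (if x \<in> cbox 0 1 then F x else 0)"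
    by (auto simp: measurable_on_def)
  \<comment> \<open>\<open>b\<close> is positive inside the cell and zero on its boundary. The
    factor min 1 (n |b|) below therefore tends to 1 at every interior point, yet makes
    \<open>G n\<close> vanish on the boundary as the uniform approximation requires.\<close>
  define b where "b x = x $ 1 * (1 - x $ 1) * (x $ 2 * (1 - x $ 2))" for x :: "real^2"
  define G where "G n x = min 1 (real n * \<bar>b x\<bar>) *\<^sub>R clamp_norm B (g n x)" for n x
  have G_cont: "continuous_on S (G n)" for n S
    unfolding G_def b_def
    by (intro continuous_intros continuous_on_compose2[OF continuous_clamp_norm[OF B, of UNIV]]
        continuous_on_subset[OF g]) auto
  have G_bd: "G n x = 0" if "x \<in> cbox 0 1 - box 0 1" for n x
  proof -
    have "b x = 0" using that by (auto simp: mem_box_cart forall_2 b_def)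
    then show ?thesis by (simp add: G_def)
  qed
  have G_norm: "cmod (G n x) \<le> B" for n x
  proof -
    have "cmod (G n x) = min 1 (real n * \<bar>b x\<bar>) * cmod (clamp_norm B (g n x))" by (simp add: G_def)
    also have "\<dots> \<le> 1 * B" by (intro mult_mono norm_clamp_norm_le B) auto
    finally show ?thesis by simp
  qed
  have G_lim: "(\<lambda>n. G n x) \<longlonglongrightarrow> clamp_norm B (F x)" if "x \<in> box 0 1" "x \<notin> N" for x
  proof -
    have "b x > 0" using that(1) by (auto simp: mem_box_cart forall_2 b_def)
    then have "filterlim (\<lambda>n. real n * \<bar>b x\<bar>) at_top sequentially"
      by (intro filterlim_at_top_mult_tendsto_pos[OF tendsto_const _ filterlim_real_sequentially]) auto
    then have "\<forall>\<^sub>F n in sequentially. real n * \<bar>b x\<bar> \<ge> 1"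
      by (simp add: filterlim_at_top)
    then have "(\<lambda>n. min 1 (real n * \<bar>b x\<bar>)) \<longlonglongrightarrow> 1"
      by (intro tendsto_eventually) (auto elim: eventually_mono)
    moreover have "(\<lambda>n. clamp_norm B (g n x)) \<longlonglongrightarrow> clamp_norm B (F x)"
      using lim[OF that(2)] subsetD[OF box_subset_cbox that(1)]
      by (intro continuous_on_tendsto_compose[OF continuous_clamp_norm[OF B, of UNIV]]) auto
    ultimately have "(\<lambda>n. G n x) \<longlonglongrightarrow> 1 *\<^sub>R clamp_norm B (F x)"
      unfolding G_def by (rule tendsto_scaleR)
    then show ?thesis by simp
  qed
  have [measurable]: "F \<in> borel_measurable cell_measure" "clamp_norm B \<in> borel_measurable borel" "G n \<in> borel_measurable cell_measure" for n
    using F B G_cont[of "cbox 0 1" n] by (auto intro: borel_measurable_continuous_onI continuous_clamp_norm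
        borel_measurable_integrable[OF continuous_integrable_cell])
  have "(\<lambda>n. LINT x|cell_measure. (cmod (clamp_norm B (F x) - G n x))\<^sup>2) \<longlonglongrightarrow> (LINT x|cell_measure. 0)"
  proof (rule integral_dominated_convergence[where w = "\<lambda>x. (2 * B)\<^sup>2"])
    have "AE x in cell_measure. x \<notin> N \<and> x \<in> box 0 1"
      using AE_cell_not_negligible[OF N] AE_cell_not_negligible[OF negligible_frontier_interval[of 0 1]] AE_space
      by eventually_elim auto
    then show "AE x in cell_measure. (\<lambda>n. (cmod (clamp_norm B (F x) - G n x))\<^sup>2) \<longlonglongrightarrow> 0"
    proof eventually_elim
      case (elim x)
      have "(\<lambda>n. (cmod (clamp_norm B (F x) - G n x))\<^sup>2) \<longlonglongrightarrow> (cmod (clamp_norm B (F x) - clamp_norm B (F x)))\<^sup>2"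
        by (intro tendsto_intros G_lim) (use elim in auto)
      then show ?case by simp
    qed
    have "cmod (clamp_norm B (F x) - G n x) \<le> 2 * B" for n x
      using norm_triangle_ineq4[of "clamp_norm B (F x)" "G n x"] norm_clamp_norm_le[OF B, of "F x"] G_norm[of n x]
      by linarith
    then have "norm ((cmod (clamp_norm B (F x) - G n x))\<^sup>2) \<le> (2 * B)\<^sup>2" for n x
      using power_mono[of "cmod (clamp_norm B (F x) - G n x)" "2 * B" 2] by simp
    then show "AE x in cell_measure. norm ((cmod (clamp_norm B (F x) - G n x))\<^sup>2) \<le> (2 * B)\<^sup>2" for n
      by (rule AE_I2)
  qed auto
  then have "\<forall>\<^sub>F n in sequentially. (LINT x|cell_measure. (cmod (clamp_norm B (F x) - G n x))\<^sup>2) < e / 4"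
    by (rule order_tendstoD) (use e in simp)
  then obtain n where n: "(LINT x|cell_measure. (cmod (clamp_norm B (F x) - G n x))\<^sup>2) < e / 4"
    by (auto simp: eventually_sequentially)
  \<comment> \<open>A uniform error below sqrt (e / 4) has mean square at most e / 4, because the
    cell has measure 1.\<close>
  have "sqrt (e / 4) > 0" using e by simp
  then obtain p where p: "trig_poly p" "\<And>x. x \<in> cbox 0 1 \<Longrightarrow> cmod (G n x - p x) < sqrt (e / 4)"
    using trig_poly_uniform_approximation[OF G_cont G_bd] by blast
  have L2: "L2_cell (\<lambda>x. clamp_norm B (F x))" "L2_cell (G n)" "L2_cell p"
  proof -
    show "L2_cell (\<lambda>x. clamp_norm B (F x))"
      by (rule L2_cell_bound[of "\<lambda>x. B\<^sup>2"]) (auto intro!: power_mono norm_clamp_norm_le B)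
    show "L2_cell (G n)" by (intro L2_cell_continuous G_cont)
    show "L2_cell p" using p(1) L2_cell_trig_sum by (auto simp: trig_poly_def)
  qed
  have "(LINT x|cell_measure. (cmod (G n x - p x))\<^sup>2) \<le> (LINT x|cell_measure. e / 4)"
  proof (rule integral_mono)
    show "integrable cell_measure (\<lambda>x. (cmod (G n x - p x))\<^sup>2)"
      by (intro L2_cell_integrable_sq L2_cell_diff L2)
    show "(cmod (G n x - p x))\<^sup>2 \<le> e / 4" if "x \<in> space cell_measure" for x
      using power_mono[OF less_imp_le[OF p(2)], of x 2] that e by simp
  qed simp
  with L2_diff_triangle[OF L2] n have "(LINT x|cell_measure. (cmod (clamp_norm B (F x) - p x))\<^sup>2) < e"
    by simp
  with p(1) show ?thesis by (rule that)
qed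

lemma trig_poly_dense:
  fixes F :: "real^2 \<Rightarrow> complex"
  assumes F: "L2_cell F" and e: "e > 0"
  obtains p where "trig_poly p" "(LINT x|cell_measure. (cmod (F x - p x))\<^sup>2) < e"
proof -
  have [measurable]: "F \<in> borel_measurable cell_measure" "clamp_norm (real (Suc n)) \<in> borel_measurable borel" for n
    using F by (auto simp: L2_cell_def intro!: borel_measurable_continuous_onI continuous_clamp_norm simp del: of_nat_Suc)
  \<comment> \<open>At each point the truncation is eventually the identity, and the squared error
    is dominated by the square of |F|. The radius is \<open>Suc n\<close> because the properties of
    the clamp ask for a positive radius.\<close>
  have "(\<lambda>n. LINT x|cell_measure. (cmod (F x - clamp_norm (real (Suc n)) (F x)))\<^sup>2) \<longlonglongrightarrow> (LINT x|cell_measure. 0)"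
  proof (rule integral_dominated_convergence[where w = "\<lambda>x. (cmod (F x))\<^sup>2"])
    show "AE x in cell_measure. (\<lambda>n. (cmod (F x - clamp_norm (real (Suc n)) (F x)))\<^sup>2) \<longlonglongrightarrow> 0"
    proof (intro AE_I2 tendsto_eventually)
      fix x
      obtain N where N: "cmod (F x) \<le> real N" using real_arch_simple by blast
      show "\<forall>\<^sub>F n in sequentially. (cmod (F x - clamp_norm (real (Suc n)) (F x)))\<^sup>2 = 0"
        unfolding eventually_sequentially
      proof (intro exI[of _ N] allI impI)
        fix n assume "N \<le> n"
        then have "cmod (F x) \<le> real (Suc n)" using N by linarith
        then show "(cmod (F x - clamp_norm (real (Suc n)) (F x)))\<^sup>2 = 0"
          by (subst clamp_norm_eq) auto
      qed
    qed
    show "AE x in cell_measure. norm ((cmod (F x - clamp_norm (real (Suc n)) (F x)))\<^sup>2) \<le> (cmod (F x))\<^sup>2" for n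
      by (auto intro!: power_mono AE_I2 norm_diff_clamp_norm_le)
  qed (use L2_cell_integrable_sq[OF F] in \<open>auto simp del: of_nat_Suc\<close>)
  then have "\<forall>\<^sub>F n in sequentially. (LINT x|cell_measure. (cmod (F x - clamp_norm (real (Suc n)) (F x)))\<^sup>2) < e / 4"
    by (rule order_tendstoD) (use e in simp)
  then obtain n where n: "(LINT x|cell_measure. (cmod (F x - clamp_norm (real (Suc n)) (F x)))\<^sup>2) < e / 4"
    by (auto simp: eventually_sequentially)
  let ?F = "\<lambda>x. clamp_norm (real (Suc n)) (F x)"
  have "e / 4 > 0" using e by simp
  then obtain p where p: "trig_poly p" "(LINT x|cell_measure. (cmod (?F x - p x))\<^sup>2) < e / 4"
    using trig_poly_dense_bounded[of F "real (Suc n)" "e / 4"] by (auto simp del: of_nat_Suc)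
  have L2: "L2_cell ?F" "L2_cell p"
  proof -
    show "L2_cell ?F"
      by (rule L2_cell_bound[of "\<lambda>x. (real (Suc n))\<^sup>2"]) (auto intro!: power_mono norm_clamp_norm_le simp del: of_nat_Suc)
    show "L2_cell p" using p(1) L2_cell_trig_sum by (auto simp: trig_poly_def)
  qed
  from L2_diff_triangle[OF F L2] n p(2) e have "(LINT x|cell_measure. (cmod (F x - p x))\<^sup>2) < e"
    by simp
  with p(1) show ?thesis by (rule that)
qed

text \<open>One finite set of modes serves the whole family: take the union of the sets found
  separately, extend the coefficients by zero, and replace them by the Fourier coefficients, which
  cannot increase the error.\<close>

lemma fourier_sum_dense:
  fixes F :: "'i \<Rightarrow> real^2 \<Rightarrow> complex"
  assumes I: "finite I" and F: "\<And>i. i \<in> I \<Longrightarrow> L2_cell (F i)" and e: "e > 0"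
  obtains K where "finite K"
    "\<And>i. i \<in> I \<Longrightarrow> (LINT x|cell_measure. (cmod (F i x - trig_sum (fourier_coeff (F i)) K x))\<^sup>2) < e"
proof -
  have "\<exists>K c. finite K \<and> (LINT x|cell_measure. (cmod (F i x - trig_sum c K x))\<^sup>2) < e" if "i \<in> I" for i
    using trig_poly_dense[OF F[OF that] e] by (metis trig_poly_def)
  then obtain K c where K: "\<And>i. i \<in> I \<Longrightarrow> finite (K i)"
    and c: "\<And>i. i \<in> I \<Longrightarrow> (LINT x|cell_measure. (cmod (F i x - trig_sum (c i) (K i) x))\<^sup>2) < e"
    by metis
  let ?K = "\<Union>i\<in>I. K i"
  have fin: "finite ?K" using I K by blast
  show ?thesis
  proof (rule that[OF fin])
    fix i assume i: "i \<in> I"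
    have *: "trig_sum (c i) (K i) = trig_sum (\<lambda>k. if k \<in> K i then c i k else 0) ?K"
      by (rule trig_sum_extend[OF fin]) (use i in blast)
    from fourier_best_approximation[OF F[OF i] fin] c[OF i]
    show "(LINT x|cell_measure. (cmod (F i x - trig_sum (fourier_coeff (F i)) ?K x))\<^sup>2) < e"
      unfolding * by (rule le_less_trans)
  qed
qed

text \<open>The termwise vanishing case of the polarised Parseval identity.\<close>

lemma integral_eq_0_if_fourier:
  fixes F G :: "'i \<Rightarrow> real^2 \<Rightarrow> complex"
  assumes I: "finite I" and F: "\<And>i. i \<in> I \<Longrightarrow> L2_cell (F i)" and G: "\<And>i. i \<in> I \<Longrightarrow> L2_cell (G i)"
    and 0: "\<And>k. (\<Sum>i\<in>I. fourier_coeff (F i) k * cnj (fourier_coeff (G i) k)) = 0"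
  shows "(\<Sum>i\<in>I. LINT x|cell_measure. F i x * cnj (G i x)) = 0"
proof -
  define A where "A = (\<Sum>i\<in>I. LINT x|cell_measure. F i x * cnj (G i x))"
  \<comment> \<open>The summand 1 pays for the approximation of \<open>G\<close>: if its mean-square
    error is below t^2, the weighted Young inequality leaves error / t, which is at most t * 1, for
    each index. The bound \<open>2 * cmod A \<le> t * C\<close> for all t > 0 then forces A =
    0.\<close>
  define C where "C = (\<Sum>i\<in>I. (LINT x|cell_measure. (cmod (F i x))\<^sup>2) + 1)"
  have C: "C \<ge> 0" unfolding C_def by (intro sum_nonneg add_nonneg_nonneg Bochner_Integration.integral_nonneg) auto
  have le: "2 * cmod A \<le> t * C" if t: "t > 0" for t
  proof -
    have "t\<^sup>2 > 0" using t by simp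
    then obtain K where K: "finite K"
      "\<And>i. i \<in> I \<Longrightarrow> (LINT x|cell_measure. (cmod (G i x - trig_sum (fourier_coeff (G i)) K x))\<^sup>2) < t\<^sup>2"
      using fourier_sum_dense[of I G, OF I G] by metis
    let ?S = "\<lambda>i. trig_sum (fourier_coeff (G i)) K"
    let ?d = "\<lambda>i x. cnj (G i x - ?S i x)"
    have d: "L2_cell (?d i)" if "i \<in> I" for i by (intro L2_cell_cnj L2_cell_diff G that L2_cell_trig_sum)
    have "(\<Sum>i\<in>I. LINT x|cell_measure. F i x * cnj (?S i x)) =
        (\<Sum>i\<in>I. \<Sum>k\<in>K. fourier_coeff (F i) k * cnj (fourier_coeff (G i) k))"
      by (simp add: integral_mult_cnj_trig_sum F mult.commute)
    also have "\<dots> = 0" by (subst sum.swap) (simp add: 0)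
    finally have S: "(\<Sum>i\<in>I. LINT x|cell_measure. F i x * cnj (?S i x)) = 0" .
    have "A = (\<Sum>i\<in>I. LINT x|cell_measure. F i x * ?d i x)"
    proof -
      have "(LINT x|cell_measure. F i x * ?d i x) =
         (LINT x|cell_measure. F i x * cnj (G i x)) - (LINT x|cell_measure. F i x * cnj (?S i x))" if "i \<in> I" for i
        unfolding complex_cnj_diff right_diff_distrib
        by (intro Bochner_Integration.integral_diff L2_integrable_mult L2_cell_cnj L2_cell_trig_sum F G that)
      then show ?thesis by (simp add: A_def sum_subtractf S)
    qed
    then have "2 * cmod A \<le> (\<Sum>i\<in>I. 2 * cmod (LINT x|cell_measure. F i x * ?d i x))"
      using norm_sum[of "\<lambda>i. LINT x|cell_measure. F i x * ?d i x" I] by (simp add: sum_distrib_left[symmetric])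
    also have "\<dots> \<le> (\<Sum>i\<in>I. t * ((LINT x|cell_measure. (cmod (F i x))\<^sup>2) + 1))"
    proof (rule sum_mono)
      fix i assume i: "i \<in> I"
      have "(LINT x|cell_measure. (cmod (?d i x))\<^sup>2) \<le> t\<^sup>2"
        using K(2)[OF i] by (simp only: complex_mod_cnj less_imp_le)
      then have "(LINT x|cell_measure. (cmod (?d i x))\<^sup>2) / t \<le> t"
        using t by (simp add: divide_le_eq power2_eq_square)
      then show "2 * cmod (LINT x|cell_measure. F i x * ?d i x) \<le> t * ((LINT x|cell_measure. (cmod (F i x))\<^sup>2) + 1)"
        using L2_product_bound[OF F[OF i] d[OF i] t] by (simp add: distrib_left)
    qed
    finally show ?thesis by (simp add: C_def sum_distrib_left)
  qed
  have "2 * cmod A \<le> 0"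
  proof (rule field_le_epsilon)
    fix e :: real assume e: "e > 0"
    have "2 * cmod A \<le> e / (C + 1) * C" by (rule le) (use C e in simp)
    also have "\<dots> \<le> e" using C e by (simp add: field_simps)
    finally show "2 * cmod A \<le> 0 + e" by simp
  qed
  then show ?thesis by (simp add: A_def)
qed

section \<open>Completeness (Riesz-Fischer) and bounded Fourier multipliers\<close>

lemma L2_cell_complete:
  fixes f :: "nat \<Rightarrow> real^2 \<Rightarrow> 'b::euclidean_space"
  assumes f: "\<And>n. L2_cell (f n)"
    and Cauchy: "\<And>e. e > 0 \<Longrightarrow> \<exists>N. \<forall>m\<ge>N. \<forall>n\<ge>N. (LINT x|cell_measure. (norm (f m x - f n x))\<^sup>2) < e"
  obtains F where "L2_cell F" "(\<lambda>n. LINT x|cell_measure. (norm (f n x - F x))\<^sup>2) \<longlonglongrightarrow> 0"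
proof -
  have [measurable]: "f n \<in> borel_measurable cell_measure" for n using f by (simp add: L2_cell_def)
  \<comment> \<open>Integrating 2 e |d| <= e^2 + |d|^2 over a cell of measure 1 shows that a
    mean-square Cauchy sequence is Cauchy in L1, which yields an almost everywhere convergent
    subsequence.\<close>
  have L1: "(LINT x|cell_measure. norm (f m x - f n x)) < e"
    if e: "e > 0" and "(LINT x|cell_measure. (norm (f m x - f n x))\<^sup>2) < e\<^sup>2" for m n e
  proof -
    have sq: "integrable cell_measure (\<lambda>x. (norm (f m x - f n x))\<^sup>2)" by (intro L2_cell_integrable_sq L2_cell_diff f)
    have "(LINT x|cell_measure. 2 * e * norm (f m x - f n x)) \<le> (LINT x|cell_measure. e\<^sup>2 + (norm (f m x - f n x))\<^sup>2)"
    proof (rule integral_mono)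
      show "integrable cell_measure (\<lambda>x. 2 * e * norm (f m x - f n x))"
        by (intro integrable_mult_right integrable_norm L2_cell_integrable L2_cell_diff f)
      show "2 * e * norm (f m x - f n x) \<le> e\<^sup>2 + (norm (f m x - f n x))\<^sup>2" for x
        using sum_squares_bound[of e "norm (f m x - f n x)"] by simp
    qed (use sq in simp)
    also have "\<dots> = e\<^sup>2 + (LINT x|cell_measure. (norm (f m x - f n x))\<^sup>2)" using sq by simp
    also have "\<dots> < e * (2 * e)" using that(2) by (simp add: power2_eq_square)
    finally have "2 * e * (LINT x|cell_measure. norm (f m x - f n x)) < 2 * e * e" by simp
    then show ?thesis using e by simp
  qed
  obtain r where r: "strict_mono r" "AE x in cell_measure. Cauchy (\<lambda>i. f (r i) x)"
  proof (rule cauchy_L1_AE_cauchy_subseq)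
    show "integrable cell_measure (f n)" for n by (rule L2_cell_integrable[OF f])
    show "\<exists>N. \<forall>i\<ge>N. \<forall>j\<ge>N. (LINT x|cell_measure. norm (f i x - f j x)) < e" if "e > 0" for e
    proof -
      have "e\<^sup>2 > 0" using that by simp
      from Cauchy[OF this] show ?thesis using L1[OF that] by blast
    qed
  qed blast
  define F where "F x = lim (\<lambda>i. f (r i) x)" for x
  have [measurable]: "F \<in> borel_measurable cell_measure"
    unfolding F_def by (rule borel_measurable_lim_metric) simp
  have lim: "AE x in cell_measure. (\<lambda>i. f (r i) x) \<longlonglongrightarrow> F x"
    using r(2) unfolding F_def by eventually_elim (simp add: Cauchy_convergent_iff convergent_LIMSEQ_iff)
  \<comment> \<open>Fatou's lemma along the subsequence, with \<open>n\<close> fixed, turns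
    pointwise convergence of the subsequence into mean-square convergence of the whole
    sequence.\<close>
  have Fatou: "\<exists>N. \<forall>n\<ge>N. (\<integral>\<^sup>+x. ennreal ((norm (f n x - F x))\<^sup>2) \<partial>cell_measure) \<le> ennreal e" if e: "e > 0" for e
  proof -
    obtain N where N: "\<And>m n. m \<ge> N \<Longrightarrow> n \<ge> N \<Longrightarrow> (LINT x|cell_measure. (norm (f m x - f n x))\<^sup>2) < e"
      using Cauchy[OF e] by blast
    show ?thesis
    proof (intro exI[of _ N] allI impI)
      fix n assume n: "n \<ge> N"
      have "(\<integral>\<^sup>+x. ennreal ((norm (f n x - F x))\<^sup>2) \<partial>cell_measure) =
          (\<integral>\<^sup>+x. liminf (\<lambda>i. ennreal ((norm (f n x - f (r i) x))\<^sup>2)) \<partial>cell_measure)"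
      proof (rule nn_integral_cong_AE)
        show "AE x in cell_measure. ennreal ((norm (f n x - F x))\<^sup>2) = liminf (\<lambda>i. ennreal ((norm (f n x - f (r i) x))\<^sup>2))"
          using lim
        proof eventually_elim
          case (elim x)
          have "(\<lambda>i. ennreal ((norm (f n x - f (r i) x))\<^sup>2)) \<longlonglongrightarrow> ennreal ((norm (f n x - F x))\<^sup>2)"
            by (intro tendsto_ennrealI tendsto_intros elim)
          then show ?case by (rule lim_imp_Liminf[symmetric, rotated]) simp
        qed
      qed
      also have "\<dots> \<le> liminf (\<lambda>i. \<integral>\<^sup>+x. ennreal ((norm (f n x - f (r i) x))\<^sup>2) \<partial>cell_measure)"
        by (rule nn_integral_liminf) simp
      also have "\<dots> \<le> ennreal e"
      proof (rule Liminf_le)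
        have "(\<integral>\<^sup>+x. ennreal ((norm (f n x - f (r i) x))\<^sup>2) \<partial>cell_measure) \<le> ennreal e" if "i \<ge> N" for i
        proof -
          have "r i \<ge> N" using seq_suble[OF r(1), of i] that by simp
          then show ?thesis
            using N[OF n, of "r i"]
            by (subst nn_integral_eq_integral) (auto intro!: L2_cell_integrable_sq L2_cell_diff f ennreal_leI)
        qed
        then show "\<forall>\<^sub>F i in sequentially. (\<integral>\<^sup>+x. ennreal ((norm (f n x - f (r i) x))\<^sup>2) \<partial>cell_measure) \<le> ennreal e"
          by (auto simp: eventually_sequentially)
      qed simp
      finally show "(\<integral>\<^sup>+x. ennreal ((norm (f n x - F x))\<^sup>2) \<partial>cell_measure) \<le> ennreal e" .
    qed
  qed
  have *: "integrable cell_measure (\<lambda>x. (norm (f n x - F x))\<^sup>2) \<and> (LINT x|cell_measure. (norm (f n x - F x))\<^sup>2) \<le> e"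
    if le: "(\<integral>\<^sup>+x. ennreal ((norm (f n x - F x))\<^sup>2) \<partial>cell_measure) \<le> ennreal e" and e: "e > 0" for n e
  proof
    show i: "integrable cell_measure (\<lambda>x. (norm (f n x - F x))\<^sup>2)"
      by (rule integrableI_nonneg) (use le_less_trans[OF le ennreal_less_top] in auto)
    show "(LINT x|cell_measure. (norm (f n x - F x))\<^sup>2) \<le> e"
      using le e by (subst (asm) nn_integral_eq_integral[OF i]) auto
  qed
  show ?thesis
  proof
    obtain N where "(\<integral>\<^sup>+x. ennreal ((norm (f N x - F x))\<^sup>2) \<partial>cell_measure) \<le> ennreal 1"
      using Fatou[of 1] by auto
    then have "L2_cell (\<lambda>x. f N x - F x)" using *[of N 1] by (simp add: L2_cell_def)
    from L2_cell_diff[OF f[of N] this] show "L2_cell F" by simp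
    show "(\<lambda>n. LINT x|cell_measure. (norm (f n x - F x))\<^sup>2) \<longlonglongrightarrow> 0"
    proof (rule LIMSEQ_I)
      fix e :: real assume e: "e > 0"
      then obtain N where "\<forall>n\<ge>N. (\<integral>\<^sup>+x. ennreal ((norm (f n x - F x))\<^sup>2) \<partial>cell_measure) \<le> ennreal (e/2)"
        using Fatou[of "e/2"] by auto
      then have "\<forall>n\<ge>N. (LINT x|cell_measure. (norm (f n x - F x))\<^sup>2) \<le> e/2"
        using *[of _ "e/2"] e by simp
      then show "\<exists>N. \<forall>n\<ge>N. norm ((LINT x|cell_measure. (norm (f n x - F x))\<^sup>2) - 0) < e"
        using e by (intro exI[of _ N] allI impI) (auto simp: abs_of_nonneg intro: le_less_trans)
    qed
  qed
qed

lemma fourier_coeff_bound: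
  assumes "L2_cell F"
  shows "(cmod (fourier_coeff F k))\<^sup>2 \<le> (LINT x|cell_measure. (cmod (F x))\<^sup>2)"
proof (cases "fourier_coeff F k = 0")
  case False
  let ?c = "cmod (fourier_coeff F k)" and ?A = "LINT x|cell_measure. (cmod (F x))\<^sup>2"
  \<comment> \<open>With the weight 1 / \<open>?c\<close> the product bound reads 2
    \<open>?c\<close> <= \<open>?A\<close> / \<open>?c\<close> + \<open>?c\<close>, since the mode
    has norm 1.\<close>
  have c: "1 / ?c > 0" using False by simp
  have "2 * ?c \<le> 1 / ?c * ?A + ?c"
    using L2_product_bound[OF assms L2_cell_cnj[OF L2_cell_fourier_mode] c, of k]
    by (simp add: fourier_coeff_def)
  then have "?c \<le> ?A / ?c" by simp
  then show ?thesis using False by (simp add: field_simps power2_eq_square)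
qed simp

lemma tendsto_fourier_coeff:
  assumes f: "\<And>n. L2_cell (f n)" and F: "L2_cell F"
    and lim: "(\<lambda>n. LINT x|cell_measure. (cmod (f n x - F x))\<^sup>2) \<longlonglongrightarrow> 0"
  shows "(\<lambda>n. fourier_coeff (f n) k) \<longlonglongrightarrow> fourier_coeff F k"
proof -
  have "(\<lambda>n. (cmod (fourier_coeff (f n) k - fourier_coeff F k))\<^sup>2) \<longlonglongrightarrow> 0"
  proof (rule tendsto_sandwich[OF _ _ tendsto_const lim])
    show "\<forall>\<^sub>F n in sequentially. (cmod (fourier_coeff (f n) k - fourier_coeff F k))\<^sup>2 \<le> (LINT x|cell_measure. (cmod (f n x - F x))\<^sup>2)"
      using fourier_coeff_bound[OF L2_cell_diff[OF f F]]
      by (simp add: fourier_coeff_diff f F)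
  qed simp
  from tendsto_real_sqrt[OF this] have "(\<lambda>n. cmod (fourier_coeff (f n) k - fourier_coeff F k)) \<longlonglongrightarrow> 0" by simp
  then show ?thesis using LIM_zero_iff tendsto_norm_zero_iff by blast
qed

text \<open>The weights lie in {-1, 0, 1} and do not depend on \<open>c\<close>. Applying a
  multiplier to \<open>c\<close> thus rescales every term of the squared norm by |m k|^2, which is
  how \<open>fourier_multiplier\<close> compares its two sequences of sums.\<close>

lemma trig_sum_diff_sets:
  assumes "finite K" "finite L"
  shows "trig_sum c K x - trig_sum c L x = trig_sum (\<lambda>k. (of_bool (k \<in> K) - of_bool (k \<in> L)) * c k) (K \<union> L) x"
proof -
  have *: "trig_sum c M = trig_sum (\<lambda>k. of_bool (k \<in> M) * c k) (K \<union> L)" if "M \<subseteq> K \<union> L" for M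
  proof -
    have "(\<lambda>k. if k \<in> M then c k else 0) = (\<lambda>k. of_bool (k \<in> M) * c k)" by auto
    then show ?thesis using trig_sum_extend[OF _ that, of c] assms by simp
  qed
  have "trig_sum c K x - trig_sum c L x = trig_sum (\<lambda>k. of_bool (k \<in> K) * c k) (K \<union> L) x -
      trig_sum (\<lambda>k. of_bool (k \<in> L) * c k) (K \<union> L) x"
    by (simp only: *[OF Un_upper1] *[OF Un_upper2])
  then show ?thesis by (simp add: trig_sum_diff left_diff_distrib)
qed

text \<open>Multiplying the coefficients of the partial sums \<open>p n\<close> by \<open>m\<close>
  gives sums \<open>q n\<close> whose mutual distances are no larger, so \<open>q\<close> is Cauchy.
  Coefficients are continuous in mean square, hence the limit of \<open>q\<close> has the prescribed
  ones.\<close>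

lemma fourier_multiplier:
  assumes h: "L2_cell h" and m: "\<And>k. cmod (m k) \<le> 1"
  obtains H where "L2_cell H" "\<And>k. fourier_coeff H k = m k * fourier_coeff h k"
proof -
  let ?c = "fourier_coeff h"
  have "\<exists>K. finite K \<and> (LINT x|cell_measure. (cmod (h x - trig_sum ?c K x))\<^sup>2) < 1 / real (Suc n)" for n
    by (rule fourier_sum_dense[of "{()}" "\<lambda>_. h" "1 / real (Suc n)"]) (use h in auto)
  then obtain K where K: "\<And>n. finite (K n)"
    and Kn: "\<And>n. (LINT x|cell_measure. (cmod (h x - trig_sum ?c (K n) x))\<^sup>2) < 1 / real (Suc n)"
    by metis
  define p where "p n = trig_sum ?c (K n)" for n
  define q where "q n = trig_sum (\<lambda>k. m k * ?c k) (K n)" for n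
  have L2: "L2_cell (p n)" "L2_cell (q n)" for n by (simp_all add: p_def q_def L2_cell_trig_sum)
  have inv: "1 / real (Suc n) \<le> 1 / real (Suc N)" if "n \<ge> N" for n N
    using that by (simp add: field_simps)
  have hp: "(LINT x|cell_measure. (cmod (p n x - h x))\<^sup>2) < 1 / real (Suc n)" for n
    using Kn[of n] by (simp add: p_def norm_minus_commute)
  have qp: "(LINT x|cell_measure. (cmod (q i x - q j x))\<^sup>2) \<le> (LINT x|cell_measure. (cmod (p i x - p j x))\<^sup>2)" for i j
    unfolding p_def q_def trig_sum_diff_sets[OF K K]
    by (subst (1 2) integral_norm_sq_trig_sum)
       (auto simp: K norm_mult power_mult_distrib intro!: sum_mono mult_left_mono mult_left_le_one_le
         power_le_one m)
  have Cauchy: "\<exists>N. \<forall>i\<ge>N. \<forall>j\<ge>N. (LINT x|cell_measure. (cmod (q i x - q j x))\<^sup>2) < e" if e: "e > 0" for e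
  proof -
    obtain N where N: "1 / real (Suc N) < e / 4"
      using reals_Archimedean[of "e / 4"] e by (auto simp: inverse_eq_divide)
    have "(LINT x|cell_measure. (cmod (q i x - q j x))\<^sup>2) < e" if ij: "i \<ge> N" "j \<ge> N" for i j
    proof -
      have "(LINT x|cell_measure. (cmod (p i x - h x))\<^sup>2) < e / 4" "(LINT x|cell_measure. (cmod (h x - p j x))\<^sup>2) < e / 4"
        using hp[of i] hp[of j] inv[OF ij(1)] inv[OF ij(2)] N by (simp_all add: norm_minus_commute)
      then show ?thesis
        using qp[of i j] L2_diff_triangle[OF L2(1)[of i] h L2(1)[of j]] by linarith
    qed
    then show ?thesis by blast
  qed
  obtain H where H: "L2_cell H" "(\<lambda>n. LINT x|cell_measure. (cmod (q n x - H x))\<^sup>2) \<longlonglongrightarrow> 0"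
    by (rule L2_cell_complete[OF L2(2) Cauchy])
  have "(\<lambda>n. LINT x|cell_measure. (cmod (p n x - h x))\<^sup>2) \<longlonglongrightarrow> 0"
  proof (rule tendsto_sandwich[OF _ _ tendsto_const LIMSEQ_inverse_real_of_nat])
    show "\<forall>\<^sub>F n in sequentially. (LINT x|cell_measure. (cmod (p n x - h x))\<^sup>2) \<le> inverse (real (Suc n))"
      using hp by (simp add: inverse_eq_divide less_imp_le)
  qed simp
  then have p_lim: "(\<lambda>n. fourier_coeff (p n) k) \<longlonglongrightarrow> ?c k" for k
    by (rule tendsto_fourier_coeff[OF L2(1) h])
  have "fourier_coeff (q n) k = m k * fourier_coeff (p n) k" for n k
    by (simp add: p_def q_def fourier_coeff_trig_sum K)
  then have "(\<lambda>n. fourier_coeff (q n) k) \<longlonglongrightarrow> m k * ?c k" for k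
    using tendsto_mult_left[OF p_lim, of "m k"] by simp
  then have "fourier_coeff H k = m k * ?c k" for k
    using tendsto_fourier_coeff[OF L2(2) H] LIMSEQ_unique by blast
  with H(1) show ?thesis by (rule that)
qed

subsection \<open>Weak gradients and divergence-free fields in Fourier space\<close>

abbreviation real_coeff :: "(real^2 \<Rightarrow> real) \<Rightarrow> int^2 \<Rightarrow> complex" where
  "real_coeff f \<equiv> fourier_coeff (\<lambda>x. complex_of_real (f x))"

lemma L2_cell_of_real: "L2_cell f \<Longrightarrow> L2_cell (\<lambda>x. complex_of_real (f x))"
  by (rule L2_cell_bounded_linear[OF bounded_linear_of_real])

lemma L2_cell_nth: "L2_cell f \<Longrightarrow> L2_cell (\<lambda>x. f x $ i)" for f :: "real^2 \<Rightarrow> ('b::euclidean_space)^2"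
  by (simp add: L2_cell_vec_iff)

lemma L2_cell_Re_Im:
  assumes "L2_cell F"
  shows "L2_cell (\<lambda>x. Re (F x))" "L2_cell (\<lambda>x. Im (F x))"
  using L2_cell_bounded_linear[OF bounded_linear_Re assms] L2_cell_bounded_linear[OF bounded_linear_Im assms] .

lemma real_coeff_eq:
  assumes "L2_cell f"
  shows "real_coeff f k =
    Complex (LINT x|cell_measure. f x * Re (fourier_mode k x)) (- (LINT x|cell_measure. f x * Im (fourier_mode k x)))"
  unfolding fourier_coeff_def
  by (subst integral_Re_Im[OF integrable_coeff[OF L2_cell_of_real[OF assms]]]) simp

text \<open>The real and imaginary parts of a mode are admissible test functions, and the gradient
  of each is a multiple of the other times \<open>wave_vector k\<close>; testing with both gives the
  complex identity.\<close>

lemma real_coeff_H1_per: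
  assumes "H1_per \<phi> g"
  shows "real_coeff (\<lambda>x. g x $ i) k = 2 * pi * \<i> * of_int (k $ i) * real_coeff \<phi> k"
proof -
  have L2: "L2_cell \<phi>" "L2_cell (\<lambda>x. g x $ i)"
    using assms L2_cell_nth by (auto simp: H1_per_def)
  have ibp: "(LINT x|cell_measure. \<phi> x * d\<psi> x $ i) = - (LINT x|cell_measure. g x $ i * \<psi> x)"
    if "C1_per \<psi> d\<psi>" for \<psi> d\<psi>
    using assms that by (simp add: H1_per_def)
  have e: "(\<lambda>x. \<phi> x * ((c * z x) *\<^sub>R wave_vector k) $ i) = (\<lambda>x. (c * of_int (k $ i)) * (\<phi> x * z x))" for c z
    by (simp add: fun_eq_iff)
  have "(LINT x|cell_measure. g x $ i * Re (fourier_mode k x)) =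
      2 * pi * of_int (k $ i) * (LINT x|cell_measure. \<phi> x * Im (fourier_mode k x))"
    using ibp[OF C1_per_Re_fourier_mode, of k] unfolding e integral_mult_right_zero by simp
  moreover have "(LINT x|cell_measure. g x $ i * Im (fourier_mode k x)) =
      - (2 * pi * of_int (k $ i) * (LINT x|cell_measure. \<phi> x * Re (fourier_mode k x)))"
    using ibp[OF C1_per_Im_fourier_mode, of k] unfolding e integral_mult_right_zero by simp
  ultimately show ?thesis
    unfolding real_coeff_eq[OF L2(1)] real_coeff_eq[OF L2(2)] by (simp add: complex_eq_iff)
qed

text \<open>Integration by parts without boundary terms: the gradient of a product of two periodic
  functions has mean zero. Test functions thereby obey the same coefficient formula as weak
  gradients.\<close>

lemma C1_per_imp_H1_per:
  assumes "C1_per \<psi> d\<psi>"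
  shows "H1_per \<psi> d\<psi>"
  unfolding H1_per_def
proof (intro conjI allI impI)
  show "periodic \<psi>" using assms by (simp add: C1_per_def)
  note c = C1_per_continuous[OF assms]
  show "L2_cell \<psi>" "L2_cell d\<psi>" by (intro L2_cell_continuous c)+
  fix \<eta> d\<eta> i assume \<eta>: "C1_per \<eta> d\<eta>"
  note c' = C1_per_continuous[OF \<eta>]
  have i: "integrable cell_measure (\<lambda>x. \<psi> x * d\<eta> x $ i)" "integrable cell_measure (\<lambda>x. d\<psi> x $ i * \<eta> x)"
    by (intro continuous_integrable_cell continuous_intros c c')+
  have "(LINT x|cell_measure. \<psi> x * d\<eta> x $ i + d\<psi> x $ i * \<eta> x) = 0"
    using integral_C1_per_gradient[OF C1_per_mult[OF assms \<eta>], of i] by (simp add: mult.commute)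
  then show "(LINT x|cell_measure. \<psi> x * d\<eta> x $ i) = - (LINT x|cell_measure. d\<psi> x $ i * \<eta> x)"
    using i by simp
qed

lemma real_coeff_div_free:
  assumes "div_free J"
  shows "(\<Sum>i\<in>UNIV. of_int (k $ i) * real_coeff (\<lambda>x. J x $ i) k) = 0"
proof -
  have J: "L2_cell J" using assms by (simp add: div_free_def)
  then have Ji: "L2_cell (\<lambda>x. J x $ i)" for i by (rule L2_cell_nth)
  have *: "(\<Sum>i\<in>UNIV. of_int (k $ i) * (LINT x|cell_measure. J x $ i * z x)) = 0"
    if z: "L2_cell z" and "(LINT x|cell_measure. J x \<bullet> ((c * z x) *\<^sub>R wave_vector k)) = 0" and "c \<noteq> 0" for z and c :: real
  proof -
    have "(\<lambda>x. J x \<bullet> ((c * z x) *\<^sub>R wave_vector k)) = (\<lambda>x. c * (\<Sum>i\<in>UNIV. of_int (k $ i) * (J x $ i * z x)))"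
      by (simp add: fun_eq_iff inner_vec_def sum_2 algebra_simps)
    then have "(LINT x|cell_measure. c * (\<Sum>i\<in>UNIV. of_int (k $ i) * (J x $ i * z x))) = 0" using that(2) by simp
    then have "(LINT x|cell_measure. (\<Sum>i\<in>UNIV. of_int (k $ i) * (J x $ i * z x))) = 0"
      using \<open>c \<noteq> 0\<close> by simp
    then show ?thesis
      by (subst (asm) Bochner_Integration.integral_sum) (auto intro!: L2_integrable_mult Ji z)
  qed
  have df: "(LINT x|cell_measure. J x \<bullet> d\<psi> x) = 0" if "C1_per \<psi> d\<psi>" for \<psi> d\<psi>
    using assms that by (simp add: div_free_def)
  note m = L2_cell_Re_Im[OF L2_cell_fourier_mode]
  have "(\<Sum>i\<in>UNIV. of_int (k $ i) * (LINT x|cell_measure. J x $ i * Im (fourier_mode k x))) = 0"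
    by (rule *[OF m(2) df[OF C1_per_Re_fourier_mode]]) simp
  moreover have "(\<Sum>i\<in>UNIV. of_int (k $ i) * (LINT x|cell_measure. J x $ i * Re (fourier_mode k x))) = 0"
    by (rule *[OF m(1) df[OF C1_per_Im_fourier_mode]]) simp
  ultimately show ?thesis
    by (simp add: real_coeff_eq[OF Ji] complex_eq_iff sum_2)
qed

lemma integral_inner_eq_0_if_fourier:
  fixes F G :: "real^2 \<Rightarrow> real^2"
  assumes F: "L2_cell F" and G: "L2_cell G"
    and 0: "\<And>k. (\<Sum>i\<in>UNIV. real_coeff (\<lambda>x. F x $ i) k * cnj (real_coeff (\<lambda>x. G x $ i) k)) = 0"
  shows "(LINT x|cell_measure. F x \<bullet> G x) = 0"
proof -
  have "(\<Sum>i\<in>UNIV. LINT x|cell_measure. complex_of_real (F x $ i) * cnj (complex_of_real (G x $ i))) = 0"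
    by (rule integral_eq_0_if_fourier) (auto intro!: L2_cell_of_real L2_cell_nth F G 0)
  then have "complex_of_real (\<Sum>i\<in>UNIV. LINT x|cell_measure. F x $ i * G x $ i) = 0"
    by (simp flip: of_real_mult)
  then have "(\<Sum>i\<in>UNIV. LINT x|cell_measure. F x $ i * G x $ i) = 0"
    by (simp only: of_real_eq_0_iff)
  then show ?thesis
    unfolding inner_vec_def
    by (subst Bochner_Integration.integral_sum) (auto intro!: L2_integrable_mult L2_cell_nth F G)
qed

text \<open>This extends the orthogonality from gradients of C^1 functions to weak gradients. At
  every \<open>k\<close> the coefficient vector of \<open>g\<close> is parallel to \<open>k\<close>
  and that of \<open>J\<close> is orthogonal to it, so the Parseval sum vanishes term by
  term.\<close>

lemma integral_div_free_gradient:
  assumes J: "div_free J" and g: "H1_per \<phi> g"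
  shows "(LINT x|cell_measure. J x \<bullet> g x) = 0"
proof (rule integral_inner_eq_0_if_fourier)
  show "L2_cell J" "L2_cell g" using assms by (simp_all add: div_free_def H1_per_def)
  fix k
  have "(\<Sum>i\<in>UNIV. real_coeff (\<lambda>x. J x $ i) k * cnj (real_coeff (\<lambda>x. g x $ i) k)) =
      cnj (2 * pi * \<i> * real_coeff \<phi> k) * (\<Sum>i\<in>UNIV. of_int (k $ i) * real_coeff (\<lambda>x. J x $ i) k)"
    unfolding real_coeff_H1_per[OF g] by (simp add: sum_2 algebra_simps)
  then show "(\<Sum>i\<in>UNIV. real_coeff (\<lambda>x. J x $ i) k * cnj (real_coeff (\<lambda>x. g x $ i) k)) = 0"
    by (simp add: real_coeff_div_free[OF J])
qed

lemma R_perp_mult: "R_perp *v v = vector [- v $ 2, v $ 1]"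
  by (simp add: R_perp_def vec_eq_iff forall_2 matrix_vector_mult_def sum_2)

text \<open>The null Lagrangian property of T: at every \<open>k\<close> both gradients have
  coefficients parallel to \<open>k\<close>, and rotating one of them by a right angle makes them
  orthogonal.\<close>

lemma div_free_R_perp_gradient:
  assumes g: "H1_per \<phi> g"
  shows "div_free (\<lambda>x. R_perp *v g x)"
  unfolding div_free_def
proof (intro conjI allI impI)
  have L2: "L2_cell g" using g by (simp add: H1_per_def)
  show L2R: "L2_cell (\<lambda>x. R_perp *v g x)"
    by (rule L2_cell_bounded_linear[OF matrix_vector_mul_bounded_linear L2])
  fix \<psi> d\<psi> assume \<psi>: "C1_per \<psi> d\<psi>"
  show "(LINT x|cell_measure. (R_perp *v g x) \<bullet> d\<psi> x) = 0"
  proof (rule integral_inner_eq_0_if_fourier[OF L2R])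
    show "L2_cell d\<psi>" by (intro L2_cell_continuous C1_per_continuous[OF \<psi>])
    fix k
    have "real_coeff (\<lambda>x. - g x $ 2) k = - real_coeff (\<lambda>x. g x $ 2) k"
      by (simp add: fourier_coeff_def)
    then show "(\<Sum>i\<in>UNIV. real_coeff (\<lambda>x. (R_perp *v g x) $ i) k * cnj (real_coeff (\<lambda>x. d\<psi> x $ i) k)) = 0"
      by (simp add: R_perp_mult sum_2 real_coeff_H1_per[OF g] real_coeff_H1_per[OF C1_per_imp_H1_per[OF \<psi>]])
  qed
qed

lemma div_free_add:
  assumes "div_free J" "div_free K"
  shows "div_free (\<lambda>x. J x + K x)"
  unfolding div_free_def
proof (intro conjI allI impI)
  have L2: "L2_cell J" "L2_cell K" using assms by (simp_all add: div_free_def)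
  then show "L2_cell (\<lambda>x. J x + K x)" by (rule L2_cell_add)
  fix \<psi> d\<psi> assume \<psi>: "C1_per \<psi> d\<psi>"
  have "L2_cell d\<psi>" by (intro L2_cell_continuous C1_per_continuous[OF \<psi>])
  then show "(LINT x|cell_measure. (J x + K x) \<bullet> d\<psi> x) = 0"
    using assms \<psi> L2 by (simp add: inner_add_left L2_integrable_inner div_free_def)
qed

lemma div_free_scaleR:
  assumes "div_free J"
  shows "div_free (\<lambda>x. c *\<^sub>R J x)"
  using assms by (auto simp: div_free_def L2_cell_bounded_linear[OF bounded_linear_scaleR_right])

lemma div_free_const: "div_free (\<lambda>x. v)"
  unfolding div_free_def
proof (intro conjI allI impI L2_cell_const)
  fix \<psi> d\<psi> assume \<psi>: "C1_per \<psi> d\<psi>"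
  have "integrable cell_measure (\<lambda>x. d\<psi> x $ i)" for i
    by (intro continuous_integrable_cell continuous_intros C1_per_continuous[OF \<psi>])
  then show "(LINT x|cell_measure. v \<bullet> d\<psi> x) = 0"
    by (simp add: inner_vec_def sum_2 integral_C1_per_gradient[OF \<psi>])
qed

lemma H1_per_add:
  assumes "H1_per \<phi> g" "H1_per \<psi> f"
  shows "H1_per (\<lambda>x. \<phi> x + \<psi> x) (\<lambda>x. g x + f x)"
  unfolding H1_per_def
proof (intro conjI allI impI)
  have L2: "L2_cell \<phi>" "L2_cell \<psi>" "L2_cell g" "L2_cell f" using assms by (simp_all add: H1_per_def)
  show "periodic (\<lambda>x. \<phi> x + \<psi> x)" using assms by (simp add: H1_per_def periodic_def)
  show "L2_cell (\<lambda>x. \<phi> x + \<psi> x)" "L2_cell (\<lambda>x. g x + f x)" by (intro L2_cell_add L2)+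
  fix \<eta> d\<eta> i assume \<eta>: "C1_per \<eta> d\<eta>"
  have \<eta>2: "L2_cell \<eta>" "L2_cell (\<lambda>x. d\<eta> x $ i)"
    by (intro L2_cell_continuous continuous_intros C1_per_continuous[OF \<eta>])+
  show "(LINT x|cell_measure. (\<phi> x + \<psi> x) * d\<eta> x $ i) = - (LINT x|cell_measure. (g x + f x) $ i * \<eta> x)"
    using assms \<eta> L2 \<eta>2 by (simp add: distrib_right L2_integrable_mult L2_cell_nth H1_per_def)
qed

lemma H1_per_scaleR:
  assumes "H1_per \<phi> g"
  shows "H1_per (\<lambda>x. c * \<phi> x) (\<lambda>x. c *\<^sub>R g x)"
  using assms unfolding H1_per_def
  by (auto simp: periodic_def mult.assoc L2_cell_mult_left L2_cell_bounded_linear[OF bounded_linear_scaleR_right])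

lemma integral_H1_per_gradient:
  assumes "H1_per \<phi> g"
  shows "(LINT x|cell_measure. g x $ i) = 0"
proof -
  have "C1_per (\<lambda>_. 1) (\<lambda>_. 0)" by (simp add: C1_per_def periodic_def)
  with assms show ?thesis unfolding H1_per_def by fastforce
qed

subsection \<open>Solving the Poisson equation for the gradient\<close>

definition frac_vec :: "real^2 \<Rightarrow> real^2" where
  "frac_vec x = (\<chi> i. frac (x $ i))"

text \<open>The extension is set to \<open>0\<close> on the boundary, so that it agrees with its own periodic
  extension on the whole closed cell and not just almost everywhere.\<close>

definition periodic_extension :: "(real^2 \<Rightarrow> real) \<Rightarrow> real^2 \<Rightarrow> real" where
  "periodic_extension f x = (if frac_vec x \<in> box 0 1 then f (frac_vec x) else 0)"

lemma periodic_periodic_extension: "periodic (periodic_extension f)"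
proof -
  have "frac (a + 1) = frac a" for a :: real
    by (simp add: frac_def)
  then have "frac_vec (x + axis i 1) = frac_vec x" for x i
    by (auto simp: frac_vec_def vec_eq_iff axis_def)
  then show ?thesis by (simp add: periodic_def periodic_extension_def)
qed

lemma periodic_extension_cell:
  assumes "x \<in> cbox 0 1"
  shows "periodic_extension f x = (if x \<in> box 0 1 then f x else 0)"
proof (cases "x \<in> box 0 1")
  case True
  then have "frac_vec x = x" by (auto simp: frac_vec_def vec_eq_iff mem_box_cart frac_eq less_imp_le)
  with True show ?thesis by (simp add: periodic_extension_def)
next
  case False
  then obtain i where "\<not> (0 < x $ i \<and> x $ i < 1)" by (auto simp: mem_box_cart)
  moreover have "0 \<le> x $ i" "x $ i \<le> 1" using assms by (auto simp: mem_box_cart)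
  ultimately have "x $ i = 0 \<or> x $ i = 1" by linarith
  then have "frac_vec x $ i = 0" by (auto simp: frac_vec_def)
  then have "frac_vec x \<notin> box 0 1" by (auto simp: mem_box_cart intro!: exI[of _ i])
  with False show ?thesis by (simp add: periodic_extension_def)
qed

lemma AE_periodic_extension: "AE x in cell_measure. periodic_extension f x = f x"
  using AE_cell_not_negligible[OF negligible_frontier_interval[of 0 1]] AE_space
  by eventually_elim (auto simp: periodic_extension_cell)

lemma L2_cell_periodic_extension:
  assumes "L2_cell f"
  shows "L2_cell (periodic_extension f)"
proof -
  have m: "box 0 (1::real^2) \<in> sets cell_measure"
    unfolding cell_measure_def unit_cell_def by (auto simp: sets_restrict_space intro!: image_eqI[of _ _ "box 0 1"] dest: subsetD[OF box_subset_cbox])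
  have [measurable]: "f \<in> borel_measurable cell_measure" using assms by (simp add: L2_cell_def)
  have "(\<lambda>x. if x \<in> box 0 1 then f x else 0) \<in> borel_measurable cell_measure"
    using m by measurable
  then have "periodic_extension f \<in> borel_measurable cell_measure"
    by (subst measurable_cong[where g = "\<lambda>x. if x \<in> box 0 1 then f x else 0"]) (simp_all add: periodic_extension_cell)
  then show ?thesis
    using L2_cell_AE_cong[OF assms, of "periodic_extension f"] AE_periodic_extension[of f] by (simp add: eq_commute)
qed

text \<open>The pairing of \<open>F\<close> with the derivative of \<open>\<psi>\<close> and that of
  \<open>G\<close> with \<open>\<psi>\<close> are treated as one family indexed by bool; their terms
  cancel at each \<open>k\<close> because 2 pi i k_i is purely imaginary. As \<open>\<psi>\<close>
  is real, real parts can be taken afterwards, which gives real potentials without knowing that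
  \<open>F\<close> is real-valued.\<close>

lemma weak_derivative_if_fourier:
  assumes F: "L2_cell F" and G: "L2_cell G" and \<psi>: "C1_per \<psi> d\<psi>"
    and eq: "\<And>k. fourier_coeff G k = 2 * pi * \<i> * of_int (k $ i) * fourier_coeff F k"
  shows "(LINT x|cell_measure. periodic_extension (\<lambda>x. Re (F x)) x * d\<psi> x $ i) = - (LINT x|cell_measure. Re (G x) * \<psi> x)"
proof -
  have L2: "L2_cell \<psi>" "L2_cell (\<lambda>x. d\<psi> x $ i)"
    by (intro L2_cell_continuous continuous_intros C1_per_continuous[OF \<psi>])+
  let ?A = "\<lambda>b. if b then F else G" and ?B = "\<lambda>b x. complex_of_real (if b then d\<psi> x $ i else \<psi> x)"
  have "(\<Sum>b\<in>UNIV. LINT x|cell_measure. ?A b x * cnj (?B b x)) = 0"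
  proof (rule integral_eq_0_if_fourier)
    show "L2_cell (?A b)" "L2_cell (?B b)" for b using F G L2 by (cases b; simp add: L2_cell_of_real)+
    show "(\<Sum>b\<in>UNIV. fourier_coeff (?A b) k * cnj (fourier_coeff (?B b) k)) = 0" for k
      by (simp add: UNIV_bool eq real_coeff_H1_per[OF C1_per_imp_H1_per[OF \<psi>]])
  qed simp
  then have "(LINT x|cell_measure. F x * complex_of_real (d\<psi> x $ i)) = - (LINT x|cell_measure. G x * complex_of_real (\<psi> x))"
    by (simp add: UNIV_bool add_eq_0_iff)
  then have "Re (LINT x|cell_measure. F x * complex_of_real (d\<psi> x $ i)) = - Re (LINT x|cell_measure. G x * complex_of_real (\<psi> x))"
    by simp
  then have *: "(LINT x|cell_measure. Re (F x) * d\<psi> x $ i) = - (LINT x|cell_measure. Re (G x) * \<psi> x)"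
    by (simp add: integral_Re_Im L2_integrable_mult F G L2 L2_cell_of_real)
  have "(LINT x|cell_measure. periodic_extension (\<lambda>x. Re (F x)) x * d\<psi> x $ i) = (LINT x|cell_measure. Re (F x) * d\<psi> x $ i)"
  proof (rule integral_cong_AE)
    have "L2_cell (\<lambda>x. Re (F x))" by (rule L2_cell_Re_Im[OF F])
    then show "(\<lambda>x. periodic_extension (\<lambda>x. Re (F x)) x * d\<psi> x $ i) \<in> borel_measurable cell_measure"
      "(\<lambda>x. Re (F x) * d\<psi> x $ i) \<in> borel_measurable cell_measure"
      by (intro borel_measurable_integrable L2_integrable_mult L2 L2_cell_periodic_extension; assumption)+
    show "AE x in cell_measure. periodic_extension (\<lambda>x. Re (F x)) x * d\<psi> x $ i = Re (F x) * d\<psi> x $ i"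
      using AE_periodic_extension[of "\<lambda>x. Re (F x)"] by eventually_elim simp
  qed
  with * show ?thesis by simp
qed

lemma H1_per_if_fourier:
  assumes F: "L2_cell F" and G: "L2_cell G1" "L2_cell G2"
    and eq: "\<And>k. fourier_coeff G1 k = 2 * pi * \<i> * of_int (k $ 1) * fourier_coeff F k"
       "\<And>k. fourier_coeff G2 k = 2 * pi * \<i> * of_int (k $ 2) * fourier_coeff F k"
  shows "H1_per (periodic_extension (\<lambda>x. Re (F x))) (\<lambda>x. vector [Re (G1 x), Re (G2 x)])"
  unfolding H1_per_def
proof (intro conjI allI impI)
  show "L2_cell (\<lambda>x. vector [Re (G1 x), Re (G2 x)] :: real^2)"
    by (auto simp: L2_cell_vec_iff forall_2 intro: L2_cell_Re_Im G)
  show "L2_cell (periodic_extension (\<lambda>x. Re (F x)))"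
    by (intro L2_cell_periodic_extension L2_cell_Re_Im F)
  fix \<psi> d\<psi> and i :: 2 assume \<psi>: "C1_per \<psi> d\<psi>"
  show "(LINT x|cell_measure. periodic_extension (\<lambda>x. Re (F x)) x * d\<psi> x $ i) =
      - (LINT x|cell_measure. vector [Re (G1 x), Re (G2 x)] $ i * \<psi> x)"
    using exhaust_2[of i] weak_derivative_if_fourier[OF F G(1) \<psi> eq(1)] weak_derivative_if_fourier[OF F G(2) \<psi> eq(2)]
    by auto
qed (rule periodic_periodic_extension)

text \<open>The solution \<open>\<nabla>u\<close> of \<open>\<Delta>u = h\<close>, with symmetric Hessian \<open>[[p, q], [q, h - p]]\<close>.\<close>

lemma gradient_of_Poisson_solution:
  assumes h: "L2_cell h" and mean: "(LINT x|cell_measure. h x) = 0"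
  obtains \<Phi>1 \<Phi>2 p q where
    "H1_per \<Phi>1 (\<lambda>x. vector [p x, q x])" "H1_per \<Phi>2 (\<lambda>x. vector [q x, h x - p x])"
proof -
  \<comment> \<open>\<open>N k\<close> is the squared length of \<open>k\<close>. With u_k = - h_k /
    (4 pi^2 N k) the multipliers below are k_j / (2 pi i N k) for the gradient of u and k_j k_l / N
    k for its Hessian. At k = 0 division by zero makes all of them 0.\<close>
  define N where "N k = (real_of_int (k $ 1))\<^sup>2 + (real_of_int (k $ 2))\<^sup>2" for k :: "int^2"
  let ?h = "\<lambda>x. complex_of_real (h x)"
  have h2: "L2_cell ?h" by (rule L2_cell_of_real[OF h])
  have h0: "fourier_coeff ?h 0 = 0" using mean by (simp add: fourier_coeff_def)
  have N: "N k \<noteq> 0" if "k \<noteq> 0" for k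
    using that by (auto simp: N_def sum_power2_eq_zero_iff vec_eq_iff forall_2)
  have N0: "N k \<ge> 0" for k by (simp add: N_def)
  \<comment> \<open>Because wave vectors are integral, their components are bounded by their
    squares; this bounds the first-order multipliers by 1.\<close>
  have int_sq: "\<bar>real_of_int n\<bar> \<le> (real_of_int n)\<^sup>2" for n
  proof -
    have "\<bar>n\<bar> \<le> n\<^sup>2"
      using self_le_power[of "\<bar>n\<bar>" 2] by (cases "n = 0") auto
    then show ?thesis by (metis of_int_abs of_int_le_iff of_int_power)
  qed
  have m1: "cmod (of_int (k $ j) / (2 * pi * \<i> * complex_of_real (N k))) \<le> 1" for k j
  proof -
    have "\<bar>of_int (k $ j)\<bar> \<le> N k"
      using exhaust_2[of j] int_sq[of "k $ j"] by (auto simp: N_def intro: order_trans)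
    also have "\<dots> \<le> 2 * pi * N k" using N0[of k] pi_gt3 by (auto simp: mult_le_cancel_right1)
    finally show ?thesis using N0[of k] by (auto simp: norm_divide norm_mult divide_le_eq)
  qed
  have m2: "cmod (of_int (k $ j) * of_int (k $ l) / complex_of_real (N k)) \<le> 1" for k j l
  proof -
    have "\<bar>of_int (k $ j) * of_int (k $ l)\<bar> \<le> N k"
    proof -
      have "\<bar>a\<bar> * \<bar>b\<bar> \<le> \<bar>a\<bar>\<^sup>2 + \<bar>b\<bar>\<^sup>2" for a b :: real
        using sum_squares_bound[of "\<bar>a\<bar>" "\<bar>b\<bar>"] mult_nonneg_nonneg[of "\<bar>a\<bar>" "\<bar>b\<bar>"]
        by linarith
      then have "\<bar>a * b\<bar> \<le> a\<^sup>2 + b\<^sup>2" "\<bar>b * a\<bar> \<le> a\<^sup>2 + b\<^sup>2" "\<bar>a * a\<bar> \<le> a\<^sup>2 + b\<^sup>2" "\<bar>b * b\<bar> \<le> a\<^sup>2 + b\<^sup>2" for a b :: real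
        by (simp_all add: abs_mult power2_eq_square mult.commute[of "\<bar>b\<bar>"])
      then show ?thesis using exhaust_2[of j] exhaust_2[of l] by (auto simp: N_def)
    qed
    then show ?thesis using N0[of k] by (auto simp: norm_divide norm_mult divide_le_eq abs_mult)
  qed
  obtain H1 where H1: "L2_cell H1" "\<And>k. fourier_coeff H1 k = of_int (k $ 1) / (2 * pi * \<i> * complex_of_real (N k)) * fourier_coeff ?h k"
    using fourier_multiplier[where m = "\<lambda>k. of_int (k $ 1) / (2 * pi * \<i> * complex_of_real (N k))", OF h2 m1] by blast
  obtain H2 where H2: "L2_cell H2" "\<And>k. fourier_coeff H2 k = of_int (k $ 2) / (2 * pi * \<i> * complex_of_real (N k)) * fourier_coeff ?h k"
    using fourier_multiplier[where m = "\<lambda>k. of_int (k $ 2) / (2 * pi * \<i> * complex_of_real (N k))", OF h2 m1] by blast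
  obtain P where P: "L2_cell P" "\<And>k. fourier_coeff P k = of_int (k $ 1) * of_int (k $ 1) / complex_of_real (N k) * fourier_coeff ?h k"
    using fourier_multiplier[where m = "\<lambda>k. of_int (k $ 1) * of_int (k $ 1) / complex_of_real (N k)", OF h2 m2] by blast
  obtain Q where Q: "L2_cell Q" "\<And>k. fourier_coeff Q k = of_int (k $ 1) * of_int (k $ 2) / complex_of_real (N k) * fourier_coeff ?h k"
    using fourier_multiplier[where m = "\<lambda>k. of_int (k $ 1) * of_int (k $ 2) / complex_of_real (N k)", OF h2 m2] by blast
  \<comment> \<open>The Poisson equation in coefficients: k_2^2 / N k = 1 - k_1^2 / N k for nonzero
    \<open>k\<close>, and at k = 0 the mean of \<open>h\<close> is zero.\<close>
  have R: "fourier_coeff (\<lambda>x. ?h x - P x) k = 2 * pi * \<i> * of_int (k $ 2) * fourier_coeff H2 k" for k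
  proof (cases "k = 0")
    case False
    have "complex_of_real (N k) = of_int (k $ 1) * of_int (k $ 1) + of_int (k $ 2) * of_int (k $ 2)"
      by (simp add: N_def power2_eq_square)
    moreover have "complex_of_real (N k) \<noteq> 0" using N[OF False] by simp
    moreover have "z - a * a / n * z = 2 * pi * \<i> * b * (b / (2 * pi * \<i> * n) * z)"
      if "n = a * a + b * b" "n \<noteq> 0" for a b n z :: complex
    proof -
      have "z - a * a / n * z = (n - a * a) / n * z" using that(2) by (simp add: field_simps)
      also have "\<dots> = b * b / n * z" using that(1) by simp
      finally show ?thesis by simp
    qed
    ultimately show ?thesis
      unfolding fourier_coeff_diff[OF h2 P(1)] P(2) H2(2) by blast
  qed (simp add: fourier_coeff_diff[OF h2 P(1)] P(2) H2(2) h0)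
  have "H1_per (periodic_extension (\<lambda>x. Re (H1 x))) (\<lambda>x. vector [Re (P x), Re (Q x)])"
    by (rule H1_per_if_fourier) (simp_all add: H1 P Q)
  moreover have "H1_per (periodic_extension (\<lambda>x. Re (H2 x))) (\<lambda>x. vector [Re (Q x), Re (?h x - P x)])"
    by (rule H1_per_if_fourier) (simp_all add: H2 Q R L2_cell_diff h2 P(1) del: minus_complex.sel)
  ultimately show ?thesis using that by simp
qed

subsection \<open>The block operators\<close>

lemma block_apply_iso_tensor:
  "block_apply (iso_tensor \<sigma> r) E = vector
    [vector [\<sigma> $ 1 $ 1 * E $ 1 $ 1 + \<sigma> $ 1 $ 2 * E $ 2 $ 1 + r * E $ 2 $ 2,
             \<sigma> $ 1 $ 1 * E $ 1 $ 2 + \<sigma> $ 1 $ 2 * E $ 2 $ 2 - r * E $ 2 $ 1],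
     vector [\<sigma> $ 2 $ 1 * E $ 1 $ 1 + \<sigma> $ 2 $ 2 * E $ 2 $ 1 - r * E $ 1 $ 2,
             \<sigma> $ 2 $ 1 * E $ 1 $ 2 + \<sigma> $ 2 $ 2 * E $ 2 $ 2 + r * E $ 1 $ 1]]"
  by (simp add: vec_eq_iff forall_2 block_apply_def iso_tensor_def kron_def T_perp_def R_perp_def
      matrix_vector_mult_def sum_2 mat_def)

lemma block_apply_T_perp: "block_apply T_perp E = vector [- (R_perp *v E $ 2), R_perp *v E $ 1]"
  by (simp add: vec_eq_iff forall_2 block_apply_def kron_def T_perp_def R_perp_def
      matrix_vector_mult_def sum_2)

lemma linear_block_apply: "linear (block_apply M)"
  by (rule linearI)
     (simp_all add: vec_eq_iff block_apply_def matrix_vector_right_distrib sum.distrib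
       matrix_vector_mult_scaleR scaleR_sum_right)

lemma bounded_linear_block_apply: "bounded_linear (block_apply M)"
  using linear_block_apply by (simp add: linear_conv_bounded_linear)

lemma block_op_eqI:
  assumes "\<And>E. block_apply M E = block_apply M' E"
  shows "M = M'"
proof -
  have *: "block_apply K (axis b v) $ a = K $ a $ b *v v" for K :: block_op and a b v
    using exhaust_2[of b] by (auto simp: block_apply_def axis_def sum_2 matrix_vector_mult_0_right)
  have "M $ a $ b = M' $ a $ b" for a b
    unfolding matrix_eq using assms[of "axis b _"] * by metis
  then show ?thesis by (simp add: vec_eq_iff)
qed

lemma sym_pos_def_2x2:
  assumes "sym_pos_def \<sigma>"
  shows "\<sigma> $ 2 $ 1 = \<sigma> $ 1 $ 2" "\<sigma> $ 1 $ 1 > 0" "det \<sigma> > 0"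
proof -
  have t: "transpose \<sigma> = \<sigma>" and pos: "\<And>v. v \<noteq> 0 \<Longrightarrow> v \<bullet> (\<sigma> *v v) > 0"
    using assms by (auto simp: sym_pos_def_def)
  show s: "\<sigma> $ 2 $ 1 = \<sigma> $ 1 $ 2"
    using arg_cong[OF t, of "\<lambda>A. A $ 1 $ 2"] by (simp add: transpose_def)
  have q: "0 < a * (\<sigma> $ 1 $ 1 * a + \<sigma> $ 1 $ 2 * b) + b * (\<sigma> $ 1 $ 2 * a + \<sigma> $ 2 $ 2 * b)"
    if "a \<noteq> 0 \<or> b \<noteq> 0" for a b
  proof -
    have "(vector [a, b] :: real^2) \<noteq> 0" using that by (auto simp: vec_eq_iff forall_2)
    from pos[OF this] show ?thesis
      by (simp add: inner_vec_def sum_2 matrix_vector_mult_def s)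
  qed
  show p: "\<sigma> $ 1 $ 1 > 0" using q[of 1 0] by simp
  \<comment> \<open>The quadratic form takes the value s11 * det at the vector (- s12, s11).\<close>
  have "0 < \<sigma> $ 1 $ 1 * det \<sigma>"
    using q[of "- \<sigma> $ 1 $ 2" "\<sigma> $ 1 $ 1"] p by (simp add: det_2 s algebra_simps)
  then show "det \<sigma> > 0" using p by (simp add: zero_less_mult_iff)
qed

lemma iso_tensor_positive:
  assumes "admissible_phase \<sigma> r" and E: "E \<noteq> 0"
  shows "E \<bullet> block_apply (iso_tensor \<sigma> r) E > 0"
proof -
  have s: "sym_pos_def \<sigma>" and r: "r\<^sup>2 < det \<sigma>"
    using assms(1) by (auto simp: admissible_phase_def)
  note d = sym_pos_def_2x2[OF s]
  define a b c where "a = \<sigma> $ 1 $ 1" and "b = \<sigma> $ 1 $ 2" and "c = \<sigma> $ 2 $ 2"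
  have a: "a > 0" and D: "a * c - b\<^sup>2 - r\<^sup>2 > 0"
    using d r by (auto simp: a_def b_def c_def det_2 power2_eq_square)
  define e11 e12 e21 e22 where "e11 = E $ 1 $ 1" and "e12 = E $ 1 $ 2" and "e21 = E $ 2 $ 1" and "e22 = E $ 2 $ 2"
  \<comment> \<open>completing the square in the first row of \<open>E\<close>\<close>
  have "a * (E \<bullet> block_apply (iso_tensor \<sigma> r) E) =
      (a * e11 + b * e21 + r * e22)\<^sup>2 + (a * e12 + b * e22 - r * e21)\<^sup>2 + (a * c - b\<^sup>2 - r\<^sup>2) * (e21\<^sup>2 + e22\<^sup>2)"
    by (simp add: block_apply_iso_tensor inner_vec_def sum_2 d(1)
        flip: a_def b_def c_def e11_def e12_def e21_def e22_def) algebra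
  also have "\<dots> > 0"
  proof (cases "e21 = 0 \<and> e22 = 0")
    case True
    then have "e11 \<noteq> 0 \<or> e12 \<noteq> 0" using E by (auto simp: vec_eq_iff forall_2 e11_def e12_def e21_def e22_def)
    then show ?thesis using True a by (simp add: sum_power2_gt_zero_iff)
  next
    case False
    then have "e21\<^sup>2 + e22\<^sup>2 > 0" by (simp add: sum_power2_gt_zero_iff)
    from mult_pos_pos[OF D this] show ?thesis
      by (rule add_nonneg_pos[OF add_nonneg_nonneg[OF zero_le_power2 zero_le_power2]])
  qed
  finally show ?thesis using a by (simp add: zero_less_mult_iff)
qed

lemma matrix_inv_eqI:
  fixes A B :: "real^'n^'n"
  assumes "A ** B = mat 1" "B ** A = mat 1"
  shows "matrix_inv A = B"
proof -
  have "A ** matrix_inv A = mat 1 \<and> matrix_inv A ** A = mat 1"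
    unfolding matrix_inv_def by (rule someI[of _ B]) (use assms in simp)
  then have "matrix_inv A = matrix_inv A ** (A ** B)" "matrix_inv A ** A = mat 1" using assms by simp_all
  then show ?thesis by (simp add: matrix_mul_assoc)
qed

lemma matrix_inv_scaleR:
  fixes A :: "real^'n^'n"
  assumes "invertible A" "k \<noteq> 0"
  shows "matrix_inv (k *\<^sub>R A) = inverse k *\<^sub>R matrix_inv A"
proof -
  obtain B where B: "A ** B = mat 1" "B ** A = mat 1" using assms(1) by (auto simp: invertible_def)
  have "matrix_inv A = B" by (rule matrix_inv_eqI[OF B])
  moreover have "matrix_inv (k *\<^sub>R A) = inverse k *\<^sub>R B"
    by (rule matrix_inv_eqI)
       (use B assms(2) in \<open>simp_all add: matrix_scalar_ac flip: scalar_matrix_assoc\<close>)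
  ultimately show ?thesis by simp
qed

lemma matrix_inv_matrix_inv:
  fixes A :: "real^'n^'n"
  assumes "invertible A"
  shows "matrix_inv (matrix_inv A) = A" "invertible (matrix_inv A)"
proof -
  obtain B where B: "A ** B = mat 1" "B ** A = mat 1" using assms(1) by (auto simp: invertible_def)
  have "matrix_inv A = B" "matrix_inv B = A" using matrix_inv_eqI B by auto
  then show "matrix_inv (matrix_inv A) = A" "invertible (matrix_inv A)"
    using B by (auto simp: invertible_def)
qed

subsection \<open>Uniqueness of the cell solution\<close>

text \<open>Energy argument: the difference of two solutions is a gradient and its flux is
  divergence-free, so the energy \<open>?w\<close> has integral zero, and positivity of
  \<open>L\<close> leaves only a difference that vanishes almost everywhere.\<close>

lemma cell_solution_AE_unique:
  assumes pos: "\<And>x E. E \<noteq> 0 \<Longrightarrow> E \<bullet> block_apply (L x) E > 0"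
    and E: "cell_solution L E0 E" and F: "cell_solution L E0 F"
  shows "AE x in cell_measure. E x = F x"
proof -
  let ?J = "\<lambda>x. block_apply (L x) (E x)" and ?K = "\<lambda>x. block_apply (L x) (F x)"
  obtain \<phi> g where g: "\<And>a. H1_per (\<phi> a) (g a)" "\<And>x. E x = E0 + (\<chi> a. g a x)"
    and J: "\<And>a. div_free (\<lambda>x. ?J x $ a)"
    using E unfolding cell_solution_def by blast
  obtain \<psi> f where f: "\<And>a. H1_per (\<psi> a) (f a)" "\<And>x. F x = E0 + (\<chi> a. f a x)"
    and K: "\<And>a. div_free (\<lambda>x. ?K x $ a)"
    using F unfolding cell_solution_def by blast
  have L2: "L2_cell (g a)" "L2_cell (f a)" "L2_cell (\<lambda>x. ?J x $ a)" "L2_cell (\<lambda>x. ?K x $ a)" for a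
    using g(1) f(1) J K by (auto simp: H1_per_def div_free_def)
  note i = L2_integrable_inner[OF L2(3) L2(1)] L2_integrable_inner[OF L2(3) L2(2)]
    L2_integrable_inner[OF L2(4) L2(1)] L2_integrable_inner[OF L2(4) L2(2)]
  note z = integral_div_free_gradient[OF J g(1)] integral_div_free_gradient[OF J f(1)]
    integral_div_free_gradient[OF K g(1)] integral_div_free_gradient[OF K f(1)]
  let ?w = "\<lambda>x. (E x - F x) \<bullet> block_apply (L x) (E x - F x)"
  \<comment> \<open>The energy is expanded into the four pairings of a flux with a gradient, because
    these are the products known to be integrable and to integrate to zero.\<close>
  have w: "?w x = (\<Sum>a\<in>UNIV. ((?J x $ a \<bullet> g a x - ?J x $ a \<bullet> f a x) - (?K x $ a \<bullet> g a x - ?K x $ a \<bullet> f a x)))" for x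
  proof -
    have "E x - F x = (\<chi> a. g a x - f a x)" by (simp add: g(2) f(2) vec_eq_iff)
    then have "?w x = (\<chi> a. g a x - f a x) \<bullet> (?J x - ?K x)"
      by (simp only: linear_diff[OF linear_block_apply, symmetric])
    also have "\<dots> = (\<Sum>a\<in>UNIV. (g a x - f a x) \<bullet> (?J x $ a - ?K x $ a))"
      by (simp only: inner_vec_def[of "\<chi> a. g a x - f a x"] vec_lambda_beta vector_minus_component)
    finally show ?thesis by (simp add: inner_diff_left inner_diff_right inner_commute algebra_simps)
  qed
  have iw: "integrable cell_measure ?w"
    unfolding w by (intro Bochner_Integration.integrable_sum Bochner_Integration.integrable_diff i)
  have "(LINT x|cell_measure. ?w x) = 0"
    unfolding w
    by (subst Bochner_Integration.integral_sum) (simp_all add: i z)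
  moreover have nn: "0 \<le> ?w x" for x
    using pos[of "E x - F x" x] by (cases "E x - F x = 0") (auto simp: less_imp_le)
  ultimately have "AE x in cell_measure. ?w x = 0"
    using integral_nonneg_eq_0_iff_AE[OF iw] by simp
  then show ?thesis
  proof eventually_elim
    case (elim x)
    then show ?case using pos[of "E x - F x" x] by fastforce
  qed
qed

text \<open>Cell solutions for the same \<open>E0\<close> agree almost everywhere, hence so do their
  fluxes, and two candidate tensors agree on every \<open>E0\<close>. The definite description can
  therefore be evaluated by exhibiting one tensor.\<close>

lemma effective_tensor_eqI:
  assumes pos: "\<And>x E. E \<noteq> 0 \<Longrightarrow> E \<bullet> block_apply (L x) E > 0"
    and Ls: "is_effective_tensor L Ls"
  shows "effective_tensor L = Ls"
  unfolding effective_tensor_def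
proof (rule the_equality[where P = "is_effective_tensor L", OF Ls])
  fix M assume M: "is_effective_tensor L M"
  show "M = Ls"
  proof (rule block_op_eqI)
    fix E0
    obtain E where E: "cell_solution L E0 E" "block_apply M E0 = (LINT x|cell_measure. block_apply (L x) (E x))"
      using M unfolding is_effective_tensor_def by blast
    obtain F where F: "cell_solution L E0 F" "block_apply Ls E0 = (LINT x|cell_measure. block_apply (L x) (F x))"
      using Ls unfolding is_effective_tensor_def by blast
    have m: "(\<lambda>x. block_apply (L x) (G x)) \<in> borel_measurable cell_measure" if "cell_solution L E0 G" for G
    proof -
      have "L2_cell (\<lambda>x. block_apply (L x) (G x))"
        unfolding L2_cell_vec_iff[of "\<lambda>x. block_apply (L x) (G x)"]
        using that by (auto simp: cell_solution_def div_free_def)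
      then show ?thesis by (simp add: L2_cell_def)
    qed
    show "block_apply M E0 = block_apply Ls E0"
      unfolding E(2) F(2)
    proof (rule integral_cong_AE[OF m[OF E(1)] m[OF F(1)]])
      have "AE x in cell_measure. E x = F x"
        by (rule cell_solution_AE_unique[OF _ E(1) F(1)]) (rule pos)
      then show "AE x in cell_measure. block_apply (L x) (E x) = block_apply (L x) (F x)"
        by eventually_elim simp
    qed
  qed
qed

subsection \<open>The explicit cell solution\<close>

text \<open>With \<open>t\<^sup>2 = det \<sigma>\<close> the operator \<open>\<sigma> \<otimes> I + t T\<close> has rank two, and on \<open>W \<nabla>\<nabla>u\<close> it only sees \<open>\<Delta>u\<close>,
  because \<open>G + R\<^sub>\<perp> G R\<^sub>\<perp>\<^sup>T\<close> is the trace of \<open>G\<close> for symmetric \<open>G\<close>.\<close>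

lemma degenerate_iso_tensor_Hessian:
  fixes \<sigma> :: "real^2^2" and E0 :: field_space
  assumes s: "\<sigma> $ 2 $ 1 = \<sigma> $ 1 $ 2" and t: "t\<^sup>2 = det \<sigma>" "t \<noteq> 0"
  defines "W \<equiv> E0 + (1 / t) *\<^sub>R (R_perp ** \<sigma> ** E0 ** transpose R_perp)"
  shows "block_apply (iso_tensor \<sigma> t)
      (\<chi> a. (W $ a $ 1) *\<^sub>R vector [p, q] + (W $ a $ 2) *\<^sub>R vector [q, h - p]) =
    h *\<^sub>R block_apply (iso_tensor \<sigma> t) E0"
proof -
  define a b c where "a = \<sigma> $ 1 $ 1" and "b = \<sigma> $ 1 $ 2" and "c = \<sigma> $ 2 $ 2"
  define e11 e12 e21 e22 where "e11 = E0 $ 1 $ 1" and "e12 = E0 $ 1 $ 2" and "e21 = E0 $ 2 $ 1" and "e22 = E0 $ 2 $ 2"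
  define w11 w12 w21 w22 where "w11 = W $ 1 $ 1" and "w12 = W $ 1 $ 2" and "w21 = W $ 2 $ 1" and "w22 = W $ 2 $ 2"
  note defs = a_def b_def c_def e11_def e12_def e21_def e22_def
  have tt: "t * t = a * c - b * b"
    using t(1) s by (simp add: det_2 defs power2_eq_square)
  have w: "t * w11 = t * e11 + (b * e12 + c * e22)" "t * w12 = t * e12 - (b * e11 + c * e21)"
    "t * w21 = t * e21 - (a * e12 + b * e22)" "t * w22 = t * e22 + (a * e11 + b * e21)"
    using t(2) unfolding w11_def w12_def w21_def w22_def W_def defs
    by (simp_all add: matrix_matrix_mult_def transpose_def R_perp_def sum_2 s distrib_left)
  \<comment> \<open>These are the four entries of sigma W G + t R W G R^T = h Q E0 with G = [[p, q],
    [q, h - p]], multiplied by \<open>t\<close> so that \<open>w\<close> and \<open>tt\<close> turn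
    them into polynomial identities. Behind them stand sigma W = Q E0, which rests on
    \<open>tt\<close>, and t R W R^T = Q E0.\<close>
  have 1: "t * (a * (w11 * p + w12 * q) + b * (w21 * p + w22 * q) + t * (w21 * q + w22 * (h - p))) = t * (h * (a * e11 + b * e21 + t * e22))"
    using w tt by algebra
  have 2: "t * (a * (w11 * q + w12 * (h - p)) + b * (w21 * q + w22 * (h - p)) - t * (w21 * p + w22 * q)) = t * (h * (a * e12 + b * e22 - t * e21))"
    using w tt by algebra
  have 3: "t * (b * (w11 * p + w12 * q) + c * (w21 * p + w22 * q) - t * (w11 * q + w12 * (h - p))) = t * (h * (b * e11 + c * e21 - t * e12))"
    using w tt by algebra
  have 4: "t * (b * (w11 * q + w12 * (h - p)) + c * (w21 * q + w22 * (h - p)) + t * (w11 * p + w12 * q)) = t * (h * (b * e12 + c * e22 + t * e11))"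
    using w tt by algebra
  show ?thesis
    unfolding block_apply_iso_tensor
    using 1 2 3 4 t(2)
    by (simp add: vec_eq_iff forall_2 s flip: defs w11_def w12_def w21_def w22_def)
qed

lemma is_effective_tensor_degenerate:
  fixes \<sigma> :: "real^2^2" and \<theta> :: "real^2 \<Rightarrow> real"
  assumes s: "\<sigma> $ 2 $ 1 = \<sigma> $ 1 $ 2" and t: "t\<^sup>2 = det \<sigma>" "t \<noteq> 0"
    and \<theta>: "\<And>x. \<theta> x > 0" "L2_cell (\<lambda>x. 1 / \<theta> x)"
    and m: "m = (LINT x|cell_measure. 1 / \<theta> x)" "m > 0"
    and L: "\<And>x. L x = iso_tensor (\<theta> x *\<^sub>R \<sigma>) (\<theta> x * t + c)"
  shows "is_effective_tensor L (iso_tensor ((1 / m) *\<^sub>R \<sigma>) (t / m + c))"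
  unfolding is_effective_tensor_def
proof
  fix E0 :: field_space
  let ?Q = "block_apply (iso_tensor \<sigma> t)" and ?T = "block_apply T_perp"
  \<comment> \<open>The phases and the effective tensor lie on the same line k Q + c T: the
    splitting is applied with k = \<open>\<theta> x\<close> to the local flux and with k = 1 /
    \<open>m\<close> to its mean.\<close>
  have Lapp: "block_apply (iso_tensor (k *\<^sub>R \<sigma>) (k * t + c)) E = k *\<^sub>R ?Q E + c *\<^sub>R ?T E" for k E
    unfolding block_apply_T_perp R_perp_mult block_apply_iso_tensor
    by (simp add: vec_eq_iff forall_2 algebra_simps)
  define h where "h x = 1 / (m * \<theta> x) - 1" for x
  have h_eq: "h = (\<lambda>x. (1 / m) * (1 / \<theta> x) - 1)" by (simp add: h_def fun_eq_iff)
  have h: "L2_cell h"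
    unfolding h_eq by (intro L2_cell_diff L2_cell_mult_left \<theta>(2) L2_cell_const)
  have "(LINT x|cell_measure. h x) = (1 / m) * (LINT x|cell_measure. 1 / \<theta> x) - 1"
    by (simp only: h_eq integral_mult_right_zero integral_cell_const
        Bochner_Integration.integral_diff[OF integrable_mult_right[OF L2_cell_integrable[OF \<theta>(2)]]
          cell.integrable_const])
  then have "(LINT x|cell_measure. h x) = 0" using m by simp
  then obtain \<Phi>1 \<Phi>2 p q where
    G: "H1_per \<Phi>1 (\<lambda>x. vector [p x, q x])" "H1_per \<Phi>2 (\<lambda>x. vector [q x, h x - p x])"
    by (rule gradient_of_Poisson_solution[OF h])
  define W where "W = E0 + (1 / t) *\<^sub>R (R_perp ** \<sigma> ** E0 ** transpose R_perp)"
  define \<phi> where "\<phi> a x = W $ a $ 1 * \<Phi>1 x + W $ a $ 2 * \<Phi>2 x" for a x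
  define g where "g a x = (W $ a $ 1) *\<^sub>R vector [p x, q x] + (W $ a $ 2) *\<^sub>R (vector [q x, h x - p x] :: real^2)" for a x
  have H1: "H1_per (\<phi> a) (g a)" for a
    unfolding \<phi>_def g_def by (intro H1_per_add H1_per_scaleR G)
  define E where "E x = E0 + (\<chi> a. g a x)" for x
  have QE: "?Q (E x) = (1 / (m * \<theta> x)) *\<^sub>R ?Q E0" for x
  proof -
    have "?Q (\<chi> a. g a x) = h x *\<^sub>R ?Q E0"
      unfolding g_def W_def by (rule degenerate_iso_tensor_Hessian[OF s t])
    then show ?thesis
      by (simp add: E_def linear_add[OF linear_block_apply] h_def scaleR_left_diff_distrib)
  qed
  have LE: "block_apply (L x) (E x) = (1 / m) *\<^sub>R ?Q E0 + c *\<^sub>R ?T (E x)" for x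
    using \<theta>(1)[of x] m(2) by (simp add: L Lapp QE)
  have T_div: "div_free (\<lambda>x. ?T (E x) $ a)" for a
  proof -
    have R: "div_free (\<lambda>x. R_perp *v E x $ b)" for b
    proof -
      have "(\<lambda>x. R_perp *v E x $ b) = (\<lambda>x. R_perp *v E0 $ b + R_perp *v g b x)"
        by (simp add: E_def matrix_vector_right_distrib)
      then show ?thesis by (simp only: div_free_add div_free_const div_free_R_perp_gradient[OF H1])
    qed
    show ?thesis
      using exhaust_2[of a] R[of 1] div_free_scaleR[OF R[of 2], of "-1"]
      by (auto simp: block_apply_T_perp)
  qed
  have "cell_solution L E0 E"
    unfolding cell_solution_def
  proof (intro conjI exI allI)
    show "H1_per (\<phi> a) (g a)" for a by (rule H1)
    show "E x = E0 + (\<chi> a. g a x)" for x by (rule E_def)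
    show "div_free (\<lambda>x. block_apply (L x) (E x) $ a)" for a
      unfolding LE vector_add_component vector_scaleR_component
      by (intro div_free_add div_free_scaleR div_free_const T_div)
  qed
  moreover have "block_apply (iso_tensor ((1 / m) *\<^sub>R \<sigma>) (t / m + c)) E0 = (LINT x|cell_measure. block_apply (L x) (E x))"
  proof -
    have L2g: "L2_cell (\<lambda>x. \<chi> a. g a x)"
      using H1 by (simp add: L2_cell_vec_iff[of "\<lambda>x. \<chi> a. g a x"] H1_per_def)
    then have ig: "integrable cell_measure (\<lambda>x. \<chi> a. g a x)" by (rule L2_cell_integrable)
    have "(LINT x|cell_measure. (\<chi> a. g a x)) $ a $ i = 0" for a i
    proof -
      have "bounded_linear (\<lambda>v::field_space. v $ a $ i)"
        using bounded_linear_compose[OF bounded_linear_vec_nth bounded_linear_vec_nth] .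
      from integral_bounded_linear[OF this ig] show ?thesis
        by (simp add: integral_H1_per_gradient[OF H1])
    qed
    then have g0: "(LINT x|cell_measure. (\<chi> a. g a x)) = 0" by (simp add: vec_eq_iff)
    have iE: "integrable cell_measure E" and intE: "(LINT x|cell_measure. E x) = E0"
      unfolding E_def using ig g0 by (simp_all add: integral_cell_const)
    have "(LINT x|cell_measure. ?T (E x)) = ?T E0"
      using integral_bounded_linear[OF bounded_linear_block_apply iE, of T_perp] by (simp add: intE)
    moreover have "integrable cell_measure (\<lambda>x. ?T (E x))"
      by (rule integrable_bounded_linear[OF bounded_linear_block_apply iE])
    ultimately have "(LINT x|cell_measure. block_apply (L x) (E x)) = (1 / m) *\<^sub>R ?Q E0 + c *\<^sub>R ?T E0"
      unfolding LE by simp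
    also have "\<dots> = block_apply (iso_tensor ((1 / m) *\<^sub>R \<sigma>) (t / m + c)) E0"
      using Lapp[of "1 / m" E0] by simp
    finally show ?thesis ..
  qed
  ultimately show "\<exists>E. cell_solution L E0 E \<and>
      block_apply (iso_tensor ((1 / m) *\<^sub>R \<sigma>) (t / m + c)) E0 = (LINT x|cell_measure. block_apply (L x) (E x))"
    by blast
qed

section \<open>Two phases: volume fractions and the explicit formula\<close>

lemma microstructure_integral:
  assumes "microstructure A1 A2"
  shows "measure lebesgue A1 + measure lebesgue A2 = 1"
    and "L2_cell (\<lambda>x. if x \<in> A1 then a else (b::real))"
    and "(LINT x|cell_measure. (if x \<in> A1 then a else b)) = a * measure lebesgue A1 + b * measure lebesgue A2"
proof -
  have A: "A1 \<in> sets lebesgue" "A2 \<in> sets lebesgue" "A1 \<union> A2 = cbox 0 1" "A1 \<inter> A2 = {}"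
    using assms by (auto simp: microstructure_def unit_cell_def)
  have m: "measure cell_measure A = measure lebesgue A" if "A \<subseteq> cbox 0 1" for A
    unfolding cell_measure_def unit_cell_def using that by (simp add: measure_restrict_space)
  have sets: "A \<in> sets cell_measure" if "A \<in> sets lebesgue" "A \<subseteq> cbox 0 1" for A
    unfolding cell_measure_def unit_cell_def using that by (auto simp: sets_restrict_space intro: image_eqI[of _ _ A])
  have s: "A1 \<in> sets cell_measure" "A2 \<in> sets cell_measure" using sets A by blast+
  have "measure cell_measure A1 + measure cell_measure A2 = measure cell_measure (A1 \<union> A2)"
    using s A(4) by (intro cell.finite_measure_Union[symmetric]) auto
  moreover have "A1 \<subseteq> cbox 0 1" "A2 \<subseteq> cbox 0 1" using A(3) by blast+
  ultimately show sum: "measure lebesgue A1 + measure lebesgue A2 = 1"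
    using m[of A1] m[of A2] A(3) by simp
  have eq: "(\<lambda>x. if x \<in> A1 then a else b) = (\<lambda>x. b + (a - b) * indicator A1 x)"
    by (auto simp: indicator_def)
  have int: "integrable cell_measure (indicator A1 :: _ \<Rightarrow> real)" using s by (simp add: cell.emeasure_eq_measure)
  show "L2_cell (\<lambda>x. if x \<in> A1 then a else b)"
  proof (rule L2_cell_bound[of "\<lambda>x. a\<^sup>2 + b\<^sup>2"])
    show "(\<lambda>x. if x \<in> A1 then a else b) \<in> borel_measurable cell_measure" using s by measurable
  qed auto
  have "(LINT x|cell_measure. (if x \<in> A1 then a else b)) = b + (a - b) * measure lebesgue A1"
  proof -
    have "A1 \<subseteq> cbox 0 1" "A1 \<inter> cbox 0 1 = A1" using A(3) by blast+
    then show ?thesis unfolding eq using int m[of A1] by (simp add: integral_cell_const)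
  qed
  also have "\<dots> = a * measure lebesgue A1 + b * measure lebesgue A2"
  proof -
    have "measure lebesgue A2 = 1 - measure lebesgue A1" using sum by simp
    then show ?thesis by (simp only:) (simp add: algebra_simps)
  qed
  finally show "(LINT x|cell_measure. (if x \<in> A1 then a else b)) = a * measure lebesgue A1 + b * measure lebesgue A2" .
qed

theorem mainTheorem7:
  fixes \<sigma>0 \<sigma>1 \<sigma>2 :: "real^2^2"
    and \<theta>1 \<theta>2 r1 r2 f1 f2 :: real
    and A1 A2 :: "(real^2) set"
  assumes "microstructure A1 A2"
    and "f1 = measure lebesgue A1" and "f2 = measure lebesgue A2"
    and "admissible_phase \<sigma>1 r1" and "admissible_phase \<sigma>2 r2"
    and "sym_pos_def \<sigma>0" and "\<theta>1 > 0" and "\<theta>2 > 0"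
    and "\<sigma>1 = \<theta>1 *\<^sub>R \<sigma>0" and "\<sigma>2 = \<theta>2 *\<^sub>R \<sigma>0"
    and "\<bar>r1 - r2\<bar> = \<bar>\<theta>1 - \<theta>2\<bar> * sqrt (det \<sigma>0)"
  shows "effective_tensor (two_phase A1 (iso_tensor \<sigma>1 r1) (iso_tensor \<sigma>2 r2)) =
           iso_tensor (matrix_inv (f1 *\<^sub>R matrix_inv \<sigma>1 + f2 *\<^sub>R matrix_inv \<sigma>2))
             ((r1 * f1 * inverse \<theta>1 + r2 * f2 * inverse \<theta>2) / (f1 * inverse \<theta>1 + f2 * inverse \<theta>2))"
proof -
  note d = sym_pos_def_2x2[OF assms(6)]
  define m where "m = f1 * inverse \<theta>1 + f2 * inverse \<theta>2"
  have f: "f1 + f2 = 1" "f1 \<ge> 0" "f2 \<ge> 0"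
    using microstructure_integral(1)[OF assms(1)] assms(2,3) by auto
  have m: "m > 0"
  proof (cases "f1 = 0")
    case True
    then show ?thesis using f assms(8) by (simp add: m_def)
  next
    case False
    then show ?thesis using f assms(7,8) by (auto simp: m_def intro!: add_pos_nonneg)
  qed
  obtain t where t: "t = sqrt (det \<sigma>0) \<or> t = - sqrt (det \<sigma>0)" "r1 - r2 = (\<theta>1 - \<theta>2) * t"
  proof (cases "r1 - r2 = (\<theta>1 - \<theta>2) * sqrt (det \<sigma>0)")
    case False
    have "\<bar>r1 - r2\<bar> = \<bar>(\<theta>1 - \<theta>2) * sqrt (det \<sigma>0)\<bar>"
      using assms(11) d(3) by (simp add: abs_mult)
    with False have "r1 - r2 = (\<theta>1 - \<theta>2) * (- sqrt (det \<sigma>0))"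
      by (simp add: abs_eq_iff)
    then show ?thesis using that by blast
  qed (use that in blast)
  have t2: "t\<^sup>2 = det \<sigma>0" "t \<noteq> 0" using t(1) d(3) by auto
  \<comment> \<open>The points (theta_j, r_j) lie on a line of slope \<open>t\<close>. Its intercept
    \<open>c\<close> brings both phases into the form that
    \<open>is_effective_tensor_degenerate\<close> expects.\<close>
  define c where "c = r1 - \<theta>1 * t"
  have r: "r1 = \<theta>1 * t + c" "r2 = \<theta>2 * t + c"
    using t(2) by (auto simp: c_def algebra_simps)
  let ?\<theta> = "\<lambda>x. if x \<in> A1 then \<theta>1 else \<theta>2"
  let ?L = "two_phase A1 (iso_tensor \<sigma>1 r1) (iso_tensor \<sigma>2 r2)"
  have inv: "(\<lambda>x. 1 / ?\<theta> x) = (\<lambda>x. if x \<in> A1 then 1 / \<theta>1 else 1 / \<theta>2)" by auto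
  have "is_effective_tensor ?L (iso_tensor ((1 / m) *\<^sub>R \<sigma>0) (t / m + c))"
  proof (rule is_effective_tensor_degenerate[where \<theta> = ?\<theta>, OF d(1) t2])
    show "L2_cell (\<lambda>x. 1 / ?\<theta> x)" unfolding inv by (rule microstructure_integral(2)[OF assms(1)])
    show "m = (LINT x|cell_measure. 1 / (?\<theta> x))"
      unfolding inv microstructure_integral(3)[OF assms(1)]
      by (simp add: m_def assms(2,3) divide_inverse mult.commute)
  qed (use assms(7-10) m r in \<open>auto simp: two_phase_def\<close>)
  moreover have "E \<bullet> block_apply (?L x) E > 0" if "E \<noteq> 0" for x E
    using that assms(4,5) by (auto simp: two_phase_def intro: iso_tensor_positive)
  ultimately have eff: "effective_tensor ?L = iso_tensor ((1 / m) *\<^sub>R \<sigma>0) (t / m + c)"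
    by (intro effective_tensor_eqI)
  have inv0: "invertible \<sigma>0" using d(3) by (simp add: invertible_det_nz)
  have "f1 *\<^sub>R matrix_inv \<sigma>1 + f2 *\<^sub>R matrix_inv \<sigma>2 = m *\<^sub>R matrix_inv \<sigma>0"
    using assms(7-10) by (simp add: matrix_inv_scaleR[OF inv0] m_def scaleR_left_distrib)
  then have "matrix_inv (f1 *\<^sub>R matrix_inv \<sigma>1 + f2 *\<^sub>R matrix_inv \<sigma>2) = (1 / m) *\<^sub>R \<sigma>0"
    using m matrix_inv_scaleR[OF matrix_inv_matrix_inv(2)[OF inv0], of m]
    by (simp add: matrix_inv_matrix_inv(1)[OF inv0] inverse_eq_divide)
  \<comment> \<open>After inserting r_j = theta_j t + c the factors theta_j cancel in the
    \<open>t\<close> part, where f1 + f2 = 1. Division by \<open>m\<close> then gives t / m +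
    c.\<close>
  moreover have "(r1 * f1 * inverse \<theta>1 + r2 * f2 * inverse \<theta>2) = t + c * m"
  proof -
    have "r1 * f1 * inverse \<theta>1 + r2 * f2 * inverse \<theta>2 = t * (f1 + f2) + c * m"
      using assms(7,8) unfolding r m_def by (simp add: field_simps)
    then show ?thesis using f(1) by simp
  qed
  ultimately show ?thesis
    unfolding eff m_def[symmetric] using m by (simp add: add_divide_distrib)
qed

end
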